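(* For every compact set $S\subset\Omega_S$ there exists a compact set $K\subset\Omega_S$ such that the following implication holds for every solution $(s(t),v(t))$ of the open-road closed-loop system described in the context: if $(s(0),v(0))\in S$, then $(s(t),v(t))\in K$ for all $t\ge 0$.
   Context: Constants: integer $n\ge 2$; $\lambda>L>0$; $v_{\max}>0$; $v^*\in(0,v_{\max})$; $\mu>0$; $\mathbb{R}_+=[0,+\infty)$. Functions: $V\in C^3((L,+\infty);\mathbb{R}_+)$ satisfies $\lim_{x\to L^+}V(x)=+\infty$, $V(x)=0$ for $x\ge\lambda$, and $V'(x)<0$, $V''(x)>0$ for $x\in(L,\lambda)$. $b:\mathbb{R}\to(v^*-v_{\max},v^* )$ is $C^2$ and increasing, with $b(0)=0$, $xb(x)>0$ for $x\ne 0$, and $b'(0)>0$. State: $s=(s_2,\dots,s_n)\in\mathbb{R}^{n-1}$, $v=(v_1,\dots,v_n)\in\mathbb{R}^n$, with the convention $s_1=s_{n+1}=+\infty$ and $V'(s_1)=V''(s_1)=V'(s_{n+1})=V''(s_{n+1})=0$ (so terms involving $v_0$ or $v_{n+1}$ below are multiplied by zero and vanish). State space (open set): $$\Omega_S=\Big\{(s,v)\in\mathbb{R}^{2n-1}:\ \min_{i=2,\dots,n}s_i>L,\ \max_{i=1,\dots,n}v_i<v_{\max},\ \min_{i=1,\dots,n}v_i>0\Big\}.$$ Define, for $i=1,\dots,n$, $$f_i(s)=v^*-b\big(V'(s_{i+1})-V'(s_i)\big),$$ $$Z_i(s,v)=-v_{\max}^2\,b'\big(V'(s_{i+1})-V'(s_i)\big)\big(V''(s_{i+1})(v_i-v_{i+1})-V''(s_i)(v_{i-1}-v_i)\big),$$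 and for $w,y\in(0,v_{\max})$ $$\beta(w,y)=\frac{v_{\max}^3(w+y)-2v_{\max}^2yw}{2(v_{\max}-w)^2w^2}\ (>0).$$ The open-road closed-loop system on $\Omega_S$ is $$\dot{s}_i=v_{i-1}-v_i,\ i=2,\dots,n,\qquad \dot{v}_i=F_i,\ i=1,\dots,n,$$ $$F_i=\frac{1}{\beta(v_i,f_i(s))}\left(\frac{Z_i(s,v)-\mu v_{\max}^2(v_i-f_i(s))}{v_i(v_{\max}-v_i)}+V'(s_i)-V'(s_{i+1})\right).$$ *)

theory Defs
  imports "HOL-Analysis.Analysis"
begin

definition Ck_on :: "nat \<Rightarrow> (real \<Rightarrow> real) \<Rightarrow> real set \<Rightarrow> bool" where
  "Ck_on k f A \<longleftrightarrow> open A \<and>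
     (\<forall>j<k. \<forall>x\<in>A. (deriv ^^ j) f differentiable (at x)) \<and>
     continuous_on A ((deriv ^^ k) f)"

text \<open>
  A state is a pair \<open>(s, v)\<close> of functions on \<open>nat\<close>, where only \<open>s\<^sub>2, \<dots>, s\<^sub>n\<close> and
  \<open>v\<^sub>1, \<dots>, v\<^sub>n\<close> are relevant; all other entries are fixed to \<open>0\<close>. The states with this
  support form a copy of the (2n-1)-dimensional Euclidean space: the product topology on the
  function type induces the Euclidean topology on them, so \<open>compact\<close> has its usual meaning for
  subsets of \<open>\<Omega>\<^sub>S\<close>.
\<close>

type_synonym state = "(nat \<Rightarrow> real) \<times> (nat \<Rightarrow> real)"

definition Omega_S :: "nat \<Rightarrow> real \<Rightarrow> real \<Rightarrow> state set" where
  "Omega_S n L vmax = {(s, v).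
     (\<forall>i. i \<notin> {2..n} \<longrightarrow> s i = 0) \<and> (\<forall>i. i \<notin> {1..n} \<longrightarrow> v i = 0) \<and>
     (\<forall>i\<in>{2..n}. L < s i) \<and> (\<forall>i\<in>{1..n}. 0 < v i \<and> v i < vmax)}"

text \<open>
  \<open>dV n V s i\<close> and \<open>ddV n V s i\<close> are \<open>V'(s\<^sub>i)\<close> and \<open>V''(s\<^sub>i)\<close>. Both vanish for \<open>i = 1\<close> and
  \<open>i = n + 1\<close>, which encodes the convention that \<open>s\<^sub>1\<close> and \<open>s\<^sub>n\<^sub>+\<^sub>1\<close> are infinite. Hence the
  entries \<open>v 0\<close> and \<open>v (n + 1)\<close> never contribute below.
\<close>

definition dV :: "nat \<Rightarrow> (real \<Rightarrow> real) \<Rightarrow> (nat \<Rightarrow> real) \<Rightarrow> nat \<Rightarrow> real" where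
  "dV n V s i = (if i \<in> {2..n} then deriv V (s i) else 0)"

definition ddV :: "nat \<Rightarrow> (real \<Rightarrow> real) \<Rightarrow> (nat \<Rightarrow> real) \<Rightarrow> nat \<Rightarrow> real" where
  "ddV n V s i = (if i \<in> {2..n} then deriv (deriv V) (s i) else 0)"

definition speed_ref ::
  "nat \<Rightarrow> (real \<Rightarrow> real) \<Rightarrow> (real \<Rightarrow> real) \<Rightarrow> real \<Rightarrow> (nat \<Rightarrow> real) \<Rightarrow> nat \<Rightarrow> real" where
  "speed_ref n V b vstar s i = vstar - b (dV n V s (i + 1) - dV n V s i)"

definition Z_term ::
  "nat \<Rightarrow> (real \<Rightarrow> real) \<Rightarrow> (real \<Rightarrow> real) \<Rightarrow> real \<Rightarrow> (nat \<Rightarrow> real) \<Rightarrow> (nat \<Rightarrow> real) \<Rightarrow> nat \<Rightarrow> real" where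
  "Z_term n V b vmax s v i =
     - vmax\<^sup>2 * deriv b (dV n V s (i + 1) - dV n V s i) *
       (ddV n V s (i + 1) * (v i - v (i + 1)) - ddV n V s i * (v (i - 1) - v i))"

definition beta :: "real \<Rightarrow> real \<Rightarrow> real \<Rightarrow> real" where
  "beta vmax w y =
     (vmax ^ 3 * (w + y) - 2 * vmax\<^sup>2 * y * w) / (2 * (vmax - w)\<^sup>2 * w\<^sup>2)"

definition accel ::
  "nat \<Rightarrow> (real \<Rightarrow> real) \<Rightarrow> (real \<Rightarrow> real) \<Rightarrow> real \<Rightarrow> real \<Rightarrow> real \<Rightarrow>
     (nat \<Rightarrow> real) \<Rightarrow> (nat \<Rightarrow> real) \<Rightarrow> nat \<Rightarrow> real" where
  "accel n V b vmax vstar \<mu> s v i =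
     1 / beta vmax (v i) (speed_ref n V b vstar s i) *
     ((Z_term n V b vmax s v i - \<mu> * vmax\<^sup>2 * (v i - speed_ref n V b vstar s i))
        / (v i * (vmax - v i))
      + dV n V s i - dV n V s (i + 1))"

text \<open>
  Solutions start at time \<open>0\<close> and live on a nondegenerate interval \<open>J\<close> of nonnegative times;
  \<open>s\<close> and \<open>v\<close> are only relevant on \<open>J\<close>. At end points in \<open>J\<close> the derivatives are one-sided.
\<close>

definition solution ::
  "nat \<Rightarrow> real \<Rightarrow> (real \<Rightarrow> real) \<Rightarrow> (real \<Rightarrow> real) \<Rightarrow> real \<Rightarrow> real \<Rightarrow> real \<Rightarrow>
     real set \<Rightarrow> (real \<Rightarrow> nat \<Rightarrow> real) \<Rightarrow> (real \<Rightarrow> nat \<Rightarrow> real) \<Rightarrow> bool" where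
  "solution n L V b vmax vstar \<mu> J s v \<longleftrightarrow>
     is_interval J \<and> {0} \<subset> J \<and> J \<subseteq> {0..} \<and>
     (\<forall>t\<in>J. (s t, v t) \<in> Omega_S n L vmax \<and>
        (\<forall>i\<in>{2..n}. ((\<lambda>t. s t i) has_real_derivative v t (i - 1) - v t i) (at t within J)) \<and>
        (\<forall>i\<in>{1..n}. ((\<lambda>t. v t i) has_real_derivative accel n V b vmax vstar \<mu> (s t) (v t) i)
           (at t within J)))"

definition maximal_solution ::
  "nat \<Rightarrow> real \<Rightarrow> (real \<Rightarrow> real) \<Rightarrow> (real \<Rightarrow> real) \<Rightarrow> real \<Rightarrow> real \<Rightarrow> real \<Rightarrow>
     real set \<Rightarrow> (real \<Rightarrow> nat \<Rightarrow> real) \<Rightarrow> (real \<Rightarrow> nat \<Rightarrow> real) \<Rightarrow> bool" where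
  "maximal_solution n L V b vmax vstar \<mu> J s v \<longleftrightarrow>
     solution n L V b vmax vstar \<mu> J s v \<and>
     (\<forall>J' s' v'. solution n L V b vmax vstar \<mu> J' s' v' \<and> J \<subseteq> J' \<and>
        (\<forall>t\<in>J. s' t = s t \<and> v' t = v t) \<longrightarrow> J' = J)"

end

theory Submission
  imports Defs "HOL-Probability.Discrete_Topology"
begin

text \<open>
  Write \<open>d\<^sub>i = V'(s\<^sub>i\<^sub>+\<^sub>1) - V'(s\<^sub>i)\<close> for the force jump at vehicle \<open>i\<close> and \<open>f\<^sub>i = vstar - b(d\<^sub>i)\<close> for its
  reference speed. In the scaled speed error \<open>q\<^sub>i = (v\<^sub>i - f\<^sub>i) / r\<^sub>i\<close> with
  \<open>r\<^sub>i = sqrt(v\<^sub>i * (vmax - v\<^sub>i))\<close> the feedback law turns into the linear equation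
  \<open>q\<^sub>i' = - \<mu> * q\<^sub>i - d\<^sub>i * r\<^sub>i / vmax\<^sup>2\<close> (lemma \<open>residual_has_derivative\<close>). Everything rests on it.

  It yields a Lyapunov function: the energy \<open>H\<close>, the sum of all \<open>V(s\<^sub>i)\<close> and of all
  \<open>vmax\<^sup>2 * q\<^sub>i\<^sup>2 / 2\<close>, satisfies \<open>H' = - \<mu> * vmax\<^sup>2 * \<Sum> q\<^sub>i\<^sup>2 - \<Sum> d\<^sub>i * b(d\<^sub>i) \<le> 0\<close>
  (\<open>energy_has_derivative\<close>). A bound on the energy keeps the spacings away from \<open>L\<close> and the speeds
  away from \<open>0\<close> and \<open>vmax\<close> (\<open>energy_sublevel_bounds\<close>).

  The energy does not bound the spacings from above, since \<open>V\<close> vanishes beyond \<open>lam\<close>. There the signs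
  in the linear equation help: while \<open>s\<^sub>i \<ge> lam\<close>, the term \<open>V'(s\<^sub>i)\<close> is zero, so \<open>d\<^sub>i\<^sub>-\<^sub>1 \<ge> 0\<close> and
  \<open>d\<^sub>i \<le> 0\<close>. Hence \<open>f\<^sub>i\<^sub>-\<^sub>1 \<le> vstar \<le> f\<^sub>i\<close>, and the positive part of \<open>q\<^sub>i\<^sub>-\<^sub>1\<close> and the negative part of
  \<open>q\<^sub>i\<close> decay like \<open>exp(- \<mu> * t)\<close>. As \<open>s\<^sub>i' = v\<^sub>i\<^sub>-\<^sub>1 - v\<^sub>i\<close>, the spacing grows by at most a constant
  during such a phase (\<open>spacing_bound\<close>).

  So all solutions that start in \<open>S\<close> stay in one compact box. The vector field is locally Lipschitz, hence local
  solutions exist at every state (\<open>local_solution\<close>), and a maximal solution confined to a compact set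
  is defined for all nonnegative times.
\<close>

section \<open>Local solutions of autonomous equations in a Banach space\<close>

text \<open>
  The integral operator is a contraction by the factor \<open>1/2\<close> once \<open>C * h \<le> 1/2\<close>, and it preserves
  curves in the ball once \<open>h\<close> times the bound \<open>B\<close> of \<open>F\<close> is at most \<open>r\<close>. Curves are taken as bounded
  continuous functions on the whole line, frozen outside \<open>[0, h]\<close> by clamping the time, because
  these functions form a complete metric space.
\<close>

lemma picard_lindelof_autonomous:
  fixes F :: "'a::banach \<Rightarrow> 'a"
  assumes r: "0 < r" and lip: "C-lipschitz_on (cball x0 r) F"
  obtains h x where "0 < h" "x 0 = x0" "\<And>t. t \<in> {0..h} \<Longrightarrow> x t \<in> cball x0 r"
    "\<And>t. t \<in> {0..h} \<Longrightarrow> (x has_vector_derivative F (x t)) (at t within {0..h})"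
proof -
  define B where "B = norm (F x0) + C * r"
  have C0: "0 \<le> C" using lip by (rule lipschitz_on_nonneg)
  have B0: "0 \<le> B" using C0 r by (simp add: B_def)
  have FB: "norm (F x) \<le> B" if "x \<in> cball x0 r" for x
  proof -
    have "dist (F x) (F x0) \<le> C * dist x x0"
      using lip that r by (auto intro: lipschitz_onD)
    also have "\<dots> \<le> C * r" using that C0 by (auto intro: mult_left_mono simp: dist_commute)
    finally show ?thesis
      using norm_triangle_ineq2[of "F x" "F x0"] by (simp add: B_def dist_norm)
  qed
  define h where "h = min (r / (B + 1)) (1 / (2 * (C + 1)))"
  have h0: "0 < h" using r B0 C0 by (simp add: h_def)
  have hB: "B * h \<le> r"
  proof -
    have "B * h \<le> (B + 1) * (r / (B + 1))"
      using B0 h0 by (intro mult_mono) (auto simp: h_def)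
    then show ?thesis using B0 by simp
  qed
  have hC: "C * h \<le> 1 / 2"
  proof -
    have "C * h \<le> (C + 1) * (1 / (2 * (C + 1)))"
      using C0 h0 by (intro mult_mono) (auto simp: h_def)
    also have "\<dots> = 1 / 2" using C0 by (simp add: field_simps)
    finally show ?thesis .
  qed
  \<comment> \<open>clamping keeps the curve constant outside \<open>[0, h]\<close>\<close>
  define cl where "cl = (\<lambda>t. max 0 (min t h))"
  have cl: "cl t \<in> {0..h}" for t using h0 by (auto simp: cl_def)
  have cl_id: "cl t = t" if "t \<in> {0..h}" for t using that by (auto simp: cl_def)
  have cl_cont: "continuous_on UNIV cl" unfolding cl_def by (intro continuous_intros)
  define S where "S = (PiC UNIV (\<lambda>_. cball x0 r) :: (real \<Rightarrow>\<^sub>C 'a) set)"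
  have SD: "apply_bcontfun u t \<in> cball x0 r" if "u \<in> S" for u t
    using that by (auto simp: S_def mem_PiC_iff)
  define G where "G = (\<lambda>(u :: real \<Rightarrow>\<^sub>C 'a) t. x0 + integral {0..cl t} (\<lambda>\<tau>. F (apply_bcontfun u \<tau>)))"
  have Fcont: "continuous_on A (\<lambda>\<tau>. F (apply_bcontfun u \<tau>))" if "u \<in> S" for u A
    by (rule continuous_on_compose2[OF lipschitz_on_continuous_on[OF lip]])
      (use SD[OF that] in \<open>auto intro: continuous_on_subset\<close>)
  have G_in: "G u t \<in> cball x0 r" if "u \<in> S" for u t
  proof -
    have "norm (integral {0..cl t} (\<lambda>\<tau>. F (apply_bcontfun u \<tau>))) \<le> B * (cl t - 0)"
      using cl[of t] Fcont[OF that] FB SD[OF that] by (intro integral_bound) auto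
    also have "\<dots> \<le> B * h" using cl[of t] B0 by (auto intro: mult_left_mono)
    also have "\<dots> \<le> r" by (rule hB)
    finally show ?thesis by (simp add: G_def dist_norm)
  qed
  have G_cont: "continuous_on UNIV (G u)" if "u \<in> S" for u
  proof -
    have "continuous_on {0..h} (\<lambda>t. integral {0..t} (\<lambda>\<tau>. F (apply_bcontfun u \<tau>)))"
      by (intro indefinite_integral_continuous_1 integrable_continuous_real Fcont[OF that])
    from continuous_on_compose2[OF this cl_cont]
    have "continuous_on UNIV (\<lambda>t. integral {0..cl t} (\<lambda>\<tau>. F (apply_bcontfun u \<tau>)))"
      using cl by blast
    then show ?thesis
      unfolding G_def by (intro continuous_on_add continuous_on_const)
  qed
  define P where "P = (\<lambda>u. Bcontfun (G u))"
  have P_app: "apply_bcontfun (P u) = G u" if "u \<in> S" for u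
  proof -
    have "bounded (range (G u))"
      using G_in[OF that] by (intro bounded_subset[OF bounded_cball]) auto
    then show ?thesis
      unfolding P_def using G_cont[OF that] by (intro Bcontfun_inverse) (simp add: bcontfun_def)
  qed
  have "\<exists>!u\<in>S. P u = u"
  proof (rule Banach_fix[of S "1/2"])
    have "closed S" unfolding S_def by (rule closed_PiC) auto
    then show "complete S" by (simp add: complete_eq_closed)
    have "const_bcontfun x0 \<in> S" using r by (simp add: S_def mem_PiC_iff)
    then show "S \<noteq> {}" by auto
    show "P ` S \<subseteq> S"
      using G_in P_app by (auto simp: S_def mem_PiC_iff)
    show "dist (P u) (P w) \<le> 1 / 2 * dist u w" if "u \<in> S" "w \<in> S" for u w
    proof (rule dist_bound)
      fix t
      have "G u t - G w t = integral {0..cl t} (\<lambda>\<tau>. F (apply_bcontfun u \<tau>) - F (apply_bcontfun w \<tau>))"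
        unfolding G_def using that
        by (simp add: integral_diff integrable_continuous_real Fcont)
      also have "norm \<dots> \<le> (C * dist u w) * (cl t - 0)"
      proof (intro integral_bound)
        fix \<tau>
        have "norm (F (apply_bcontfun u \<tau>) - F (apply_bcontfun w \<tau>))
          \<le> C * dist (apply_bcontfun u \<tau>) (apply_bcontfun w \<tau>)"
          unfolding dist_norm[symmetric] by (rule lipschitz_onD[OF lip SD SD]) (use that in auto)
        also have "\<dots> \<le> C * dist u w" using C0 by (intro mult_left_mono dist_bounded)
        finally show "norm (F (apply_bcontfun u \<tau>) - F (apply_bcontfun w \<tau>)) \<le> C * dist u w" .
      qed (use cl[of t] that in \<open>auto intro!: continuous_on_diff Fcont\<close>)
      also have "\<dots> \<le> (C * dist u w) * h"
        using cl[of t] C0 by (intro mult_left_mono) auto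
      also have "\<dots> = (C * h) * dist u w" by simp
      also have "\<dots> \<le> 1 / 2 * dist u w" using hC by (intro mult_right_mono) auto
      finally show "dist (apply_bcontfun (P u) t) (apply_bcontfun (P w) t) \<le> 1 / 2 * dist u w"
        using that by (simp add: P_app dist_norm)
    qed
  qed auto
  then obtain u where u: "u \<in> S" "P u = u" by auto
  have eq: "apply_bcontfun u t = x0 + integral {0..cl t} (\<lambda>\<tau>. F (apply_bcontfun u \<tau>))" for t
  proof -
    have "apply_bcontfun u t = G u t" using P_app[OF u(1)] u(2) by metis
    then show ?thesis by (simp only: G_def)
  qed
  show ?thesis
  proof (rule that[of h "apply_bcontfun u"])
    show "apply_bcontfun u 0 = x0" using eq[of 0] h0 by (simp add: cl_def)
    fix t assume t: "t \<in> {0..h}"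
    have "((\<lambda>t. x0 + integral {0..t} (\<lambda>\<tau>. F (apply_bcontfun u \<tau>))) has_vector_derivative
        F (apply_bcontfun u t)) (at t within {0..h})"
      using has_vector_derivative_add[OF has_vector_derivative_const
          integral_has_vector_derivative[OF Fcont[OF u(1)] t]] by simp
    then show "(apply_bcontfun u has_vector_derivative F (apply_bcontfun u t)) (at t within {0..h})"
      by (rule has_vector_derivative_transform[OF t, rotated]) (subst eq, simp add: cl_id)
  qed (use h0 SD[OF u(1)] in auto)
qed

section \<open>Functions that are Lipschitz near a point\<close>

text \<open>
  Lipschitz continuity on some ball, with no control on its radius or constant. Only local solutions
  are needed, and in this form the property passes to products, quotients and compositions without
  bookkeeping of domains.
\<close>

definition lipschitz_near :: "('a::metric_space \<Rightarrow> 'b::metric_space) \<Rightarrow> 'a \<Rightarrow> bool" where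
  "lipschitz_near f x \<longleftrightarrow> (\<exists>e>0. \<exists>C. C-lipschitz_on (cball x e) f)"

lemma lipschitz_on_imp_near: "C-lipschitz_on UNIV f \<Longrightarrow> lipschitz_near f x"
  unfolding lipschitz_near_def by (metis lipschitz_on_subset subset_UNIV zero_less_one)

lemma lipschitz_near_const: "lipschitz_near (\<lambda>_. c) x"
  by (rule lipschitz_on_imp_near[OF lipschitz_on_constant])

lemma lipschitz_near_common_ball:
  assumes "lipschitz_near f x" "lipschitz_near g x"
  obtains e C D where "0 < e" "C-lipschitz_on (cball x e) f" "D-lipschitz_on (cball x e) g"
proof -
  obtain e1 C where 1: "0 < e1" "C-lipschitz_on (cball x e1) f"
    using assms by (auto simp: lipschitz_near_def)
  obtain e2 D where 2: "0 < e2" "D-lipschitz_on (cball x e2) g"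
    using assms by (auto simp: lipschitz_near_def)
  show ?thesis
    by (rule that[of "min e1 e2" C D]) (use 1 2 in \<open>auto elim!: lipschitz_on_subset\<close>)
qed

lemma lipschitz_near_add:
  fixes f g :: "'a::metric_space \<Rightarrow> 'b::real_normed_vector"
  shows "lipschitz_near f x \<Longrightarrow> lipschitz_near g x \<Longrightarrow> lipschitz_near (\<lambda>y. f y + g y) x"
  by (erule lipschitz_near_common_ball, assumption)
    (auto simp: lipschitz_near_def intro: lipschitz_on_add)

lemma lipschitz_near_diff:
  fixes f g :: "'a::metric_space \<Rightarrow> 'b::real_normed_vector"
  shows "lipschitz_near f x \<Longrightarrow> lipschitz_near g x \<Longrightarrow> lipschitz_near (\<lambda>y. f y - g y) x"
  by (erule lipschitz_near_common_ball, assumption)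
    (auto simp: lipschitz_near_def intro: lipschitz_on_diff)

lemma lipschitz_near_Pair:
  shows "lipschitz_near f x \<Longrightarrow> lipschitz_near g x \<Longrightarrow> lipschitz_near (\<lambda>y. (f y, g y)) x"
  by (erule lipschitz_near_common_ball, assumption)
    (auto simp: lipschitz_near_def intro: lipschitz_on_Pair)

lemma lipschitz_near_mult:
  fixes f g :: "'a::metric_space \<Rightarrow> real"
  assumes "lipschitz_near f x" "lipschitz_near g x"
  shows "lipschitz_near (\<lambda>y. f y * g y) x"
proof -
  obtain e C D where e: "0 < e" and f: "C-lipschitz_on (cball x e) f" and g: "D-lipschitz_on (cball x e) g"
    using lipschitz_near_common_ball[OF assms] by metis
  have bnd: "\<bar>k y\<bar> \<le> \<bar>k x\<bar> + E * e" if "E-lipschitz_on (cball x e) k" "y \<in> cball x e"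
    for k :: "'a \<Rightarrow> real" and E y
  proof -
    have "dist (k y) (k x) \<le> E * dist y x" using that e by (auto intro: lipschitz_onD)
    also have "\<dots> \<le> E * e" using that lipschitz_on_nonneg[OF that(1)]
      by (auto intro: mult_left_mono simp: dist_commute)
    finally show ?thesis by (auto simp: dist_real_def)
  qed
  define A B where "A = \<bar>f x\<bar> + C * e" and "B = \<bar>g x\<bar> + D * e"
  have CD: "0 \<le> C" "0 \<le> D" using f g lipschitz_on_nonneg by auto
  have AB: "0 \<le> A" "0 \<le> B" using CD e by (auto simp: A_def B_def)
  have "(A * D + C * B)-lipschitz_on (cball x e) (\<lambda>y. f y * g y)"
  proof (rule lipschitz_onI)
    fix y z assume yz: "y \<in> cball x e" "z \<in> cball x e"
    have "f y * g y - f z * g z = f y * (g y - g z) + (f y - f z) * g z" by (simp add: algebra_simps)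
    then have "\<bar>f y * g y - f z * g z\<bar> \<le> \<bar>f y\<bar> * \<bar>g y - g z\<bar> + \<bar>f y - f z\<bar> * \<bar>g z\<bar>"
      by (metis abs_mult abs_triangle_ineq)
    also have "\<dots> \<le> A * (D * dist y z) + (C * dist y z) * B"
      using bnd[OF f yz(1)] bnd[OF g yz(2)] lipschitz_onD[OF f yz] lipschitz_onD[OF g yz] CD AB
      by (intro add_mono mult_mono) (auto simp: A_def B_def dist_real_def)
    finally show "dist (f y * g y) (f z * g z) \<le> (A * D + C * B) * dist y z"
      by (simp add: dist_real_def algebra_simps)
  qed (use CD AB in auto)
  then show ?thesis using e by (auto simp: lipschitz_near_def)
qed

lemma lipschitz_near_compose:
  assumes g: "lipschitz_near g (f x)" and f: "lipschitz_near f x"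
  shows "lipschitz_near (\<lambda>y. g (f y)) x"
proof -
  obtain d D where d: "0 < d" "D-lipschitz_on (cball (f x) d) g"
    using g by (auto simp: lipschitz_near_def)
  obtain e C where e: "0 < e" "C-lipschitz_on (cball x e) f"
    using f by (auto simp: lipschitz_near_def)
  have C0: "0 \<le> C" using e lipschitz_on_nonneg by auto
  define e' where "e' = min e (d / (C + 1))"
  have e': "0 < e'" using d e C0 by (simp add: e'_def)
  have f': "C-lipschitz_on (cball x e') f"
    by (rule lipschitz_on_subset[OF e(2)]) (auto simp: e'_def)
  have "f ` cball x e' \<subseteq> cball (f x) d"
  proof safe
    fix y assume y: "y \<in> cball x e'"
    have "dist (f x) (f y) \<le> C * dist x y" using y e' by (intro lipschitz_onD[OF f']) auto
    also have "\<dots> \<le> (C + 1) * (d / (C + 1))"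
      using y C0 by (intro mult_mono) (auto simp: e'_def)
    finally show "f y \<in> cball (f x) d" using C0 by simp
  qed
  then have "(D * C)-lipschitz_on (cball x e') (g \<circ> f)"
    by (intro lipschitz_on_compose f' lipschitz_on_subset[OF d(2)])
  then show ?thesis using e' by (auto simp: lipschitz_near_def o_def)
qed

lemma C1_imp_lipschitz_near:
  fixes g g' :: "real \<Rightarrow> real"
  assumes "open U" "x \<in> U" and g: "\<And>y. y \<in> U \<Longrightarrow> (g has_real_derivative g' y) (at y)"
    and cont: "continuous_on U g'"
  shows "lipschitz_near g x"
proof -
  obtain e where e: "0 < e" "cball x e \<subseteq> U" using assms(1,2) open_contains_cball by blast
  have "compact (g' ` cball x e)"
    using e by (intro compact_continuous_image continuous_on_subset[OF cont]) auto
  then obtain B where B: "\<And>y. y \<in> cball x e \<Longrightarrow> \<bar>g' y\<bar> \<le> B"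
    using compact_imp_bounded bounded_iff by (metis imageI real_norm_def)
  have "B-lipschitz_on (cball x e) g"
  proof (rule lipschitz_onI)
    fix y z assume yz: "y \<in> cball x e" "z \<in> cball x e"
    have "norm (g y - g z) \<le> B * norm (y - z)"
      by (rule field_differentiable_bound[of "cball x e" g g'])
        (use yz e B in \<open>auto intro: has_field_derivative_at_within[OF g]\<close>)
    then show "dist (g y) (g z) \<le> B * dist y z" by (simp add: dist_norm)
  next
    show "0 \<le> B" using B[of x] e by auto
  qed
  then show ?thesis using e by (auto simp: lipschitz_near_def)
qed

lemma lipschitz_near_divide:
  fixes f g :: "'a::metric_space \<Rightarrow> real"
  assumes "lipschitz_near f x" "lipschitz_near g x" "g x \<noteq> 0"
  shows "lipschitz_near (\<lambda>y. f y / g y) x"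
proof -
  have "lipschitz_near inverse (g x)"
    by (rule C1_imp_lipschitz_near[of "- {0}" _ _ "\<lambda>x. - (inverse x ^ 2)"])
      (use assms in \<open>auto intro!: continuous_intros DERIV_inverse[of _ UNIV, unfolded numeral_2_eq_2[symmetric]]\<close>)
  from lipschitz_near_mult[OF assms(1) lipschitz_near_compose[OF this assms(2)]]
  show ?thesis by (simp add: divide_inverse)
qed

lemma lipschitz_near_power:
  fixes f :: "'a::metric_space \<Rightarrow> real"
  assumes "lipschitz_near f x"
  shows "lipschitz_near (\<lambda>y. f y ^ k) x"
  by (induction k) (auto intro: lipschitz_near_const lipschitz_near_mult assms)

section \<open>Curves on an interval of nonnegative times\<close>

lemma bounded_derivative_left_limit:
  fixes g g' :: "real \<Rightarrow> real"
  assumes T: "0 < T" and g: "\<And>t. t \<in> {0..<T} \<Longrightarrow> (g has_real_derivative g' t) (at t within {0..<T})"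
    and B: "\<And>t. t \<in> {0..<T} \<Longrightarrow> \<bar>g' t\<bar> \<le> B"
  obtains l where "continuous_on {0..T} (\<lambda>t. if t < T then g t else l)"
proof -
  have "B-lipschitz_on {0..<T} g"
  proof (rule lipschitz_onI)
    fix y z assume yz: "y \<in> {0..<T}" "z \<in> {0..<T}"
    have "norm (g y - g z) \<le> B * norm (y - z)"
      by (rule field_differentiable_bound[of "{0..<T}" g g']) (use yz B g in auto)
    then show "dist (g y) (g z) \<le> B * dist y z" by (simp add: dist_norm)
  next
    show "0 \<le> B" using B[of 0] T by auto
  qed
  from lipschitz_extend_closure[OF this] obtain k where
    k: "B-lipschitz_on {0..T} k" "\<And>t. t \<in> {0..<T} \<Longrightarrow> k t = g t"
    using T by auto
  have "continuous_on {0..T} (\<lambda>t. if t < T then g t else k T)"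
    using lipschitz_on_continuous_on[OF k(1)] k(2)
    by (subst continuous_on_cong[OF refl, of _ _ k]) auto
  then show ?thesis by (rule that)
qed

text \<open>
  Both sides of the differential equation are continuous up to the end points, so its integrated
  form holds on the closed interval; differentiating that form gives the one-sided derivatives.
\<close>

lemma derivative_extends_to_endpoints:
  fixes g \<phi> :: "real \<Rightarrow> real"
  assumes g: "continuous_on {0..T} g" and \<phi>: "continuous_on {0..T} \<phi>"
    and der: "\<And>t. t \<in> {0<..<T} \<Longrightarrow> (g has_real_derivative \<phi> t) (at t)" and t: "t \<in> {0..T}"
  shows "(g has_real_derivative \<phi> t) (at t within {0..T})"
proof -
  have rep: "g u = g 0 + integral {0..u} \<phi>" if u: "u \<in> {0..T}" for u
  proof -
    have "(\<phi> has_integral (g u - g 0)) {0..u}"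
      using u der by (intro fundamental_theorem_of_calculus_interior continuous_on_subset[OF g])
        (auto simp: has_real_derivative_iff_has_vector_derivative)
    then show ?thesis by (simp add: integral_unique)
  qed
  have der_rep: "((\<lambda>u. g 0 + integral {0..u} \<phi>) has_real_derivative \<phi> t) (at t within {0..T})"
    using DERIV_add[OF DERIV_const integral_has_real_derivative[OF \<phi> t]] by simp
  show ?thesis
    using has_vector_derivative_transform[OF t rep] der_rep
    by (simp add: has_real_derivative_iff_has_vector_derivative)
qed

lemma has_real_derivative_glue:
  fixes f g \<phi> \<psi> :: "real \<Rightarrow> real"
  assumes T: "a \<le> T" "T \<le> c"
    and f: "\<And>t. t \<in> {a..T} \<Longrightarrow> (f has_real_derivative \<phi> t) (at t within {a..T})"
    and g: "\<And>t. t \<in> {T..c} \<Longrightarrow> (g has_real_derivative \<psi> t) (at t within {T..c})"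
    and eq: "f T = g T" "\<phi> T = \<psi> T" and t: "t \<in> {a..c}"
  shows "((\<lambda>t. if t \<le> T then f t else g t) has_real_derivative (if t \<le> T then \<phi> t else \<psi> t))
    (at t within {a..c})"
proof -
  have cl: "closure {a..T} \<inter> closure {T..c} = {T}" using T by auto
  have "((\<lambda>t. if t \<in> {a..T} then f t else g t) has_vector_derivative
      (if t \<in> {a..T} then \<phi> t else \<psi> t)) (at t within {a..c})"
  proof (rule has_vector_derivative_If_within_closures[where T = "{T..c}"])
    show "(f has_vector_derivative \<phi> t) (at t within {a..T} \<union> closure {a..T} \<inter> closure {T..c})"
      if "t \<in> {a..T} \<union> closure {a..T} \<inter> closure {T..c}"
      using that f[of t] T unfolding cl
      by (auto simp: has_real_derivative_iff_has_vector_derivative insert_absorb)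
    show "(g has_vector_derivative \<psi> t) (at t within {T..c} \<union> closure {a..T} \<inter> closure {T..c})"
      if "t \<in> {T..c} \<union> closure {a..T} \<inter> closure {T..c}"
      using that g[of t] T unfolding cl
      by (auto simp: has_real_derivative_iff_has_vector_derivative insert_absorb)
  qed (use t T eq in auto)
  then show ?thesis
    using t by (auto simp: has_real_derivative_iff_has_vector_derivative
        elim!: has_vector_derivative_transform[rotated 2] split: if_splits)
qed

lemma nonincreasing_on_interval:
  fixes f f' :: "real \<Rightarrow> real"
  assumes J: "is_interval J" "a \<in> J" "c \<in> J" and "a \<le> c"
    and f: "\<And>t. t \<in> J \<Longrightarrow> (f has_real_derivative f' t) (at t within J)"
    and le: "\<And>t. t \<in> {a<..<c} \<Longrightarrow> f' t \<le> 0"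
  shows "f c \<le> f a"
proof (rule DERIV_nonpos_imp_decreasing_open[OF \<open>a \<le> c\<close>])
  have sub: "{a..c} \<subseteq> J" using mem_is_interval_1_I[OF J] by auto
  have "continuous_on J f" using f by (rule DERIV_continuous_on)
  then show "continuous_on {a..c} f" by (rule continuous_on_subset[OF _ sub])
  fix t assume t: "a < t" "t < c"
  then have "t \<in> interior J"
    using sub interior_maximal[of "{a<..<c}" J] by fastforce
  then have "(f has_real_derivative f' t) (at t)"
    using f[of t] interior_subset[of J] by (metis at_within_interior subsetD)
  then show "\<exists>y. (f has_real_derivative y) (at t) \<and> y \<le> 0" using le t by auto
qed

lemma interval_from_zero_cases:
  fixes J :: "real set"
  assumes J: "is_interval J" "{0} \<subset> J" "J \<subseteq> {0..}"
  obtains "J = {0..}" | T where "0 < T" "J = {0..<T}" | T where "0 < T" "J = {0..T}"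
proof (cases "bdd_above J")
  case False
  have "x \<in> J" if "0 \<le> x" for x
  proof -
    obtain y where "y \<in> J" "x < y" using False by (auto simp: bdd_above_def not_le)
    then show ?thesis using J that mem_is_interval_1_I[OF J(1), of 0 y x] by auto
  qed
  then show ?thesis using J that(1) by auto
next
  case True
  define T where "T = Sup J"
  obtain z where z: "z \<in> J" "z \<noteq> 0" using J by auto
  have up: "x \<le> T" if "x \<in> J" for x unfolding T_def using that True by (rule cSup_upper)
  have T0: "0 < T" using up[OF z(1)] z J by force
  have lt: "x \<in> J" if "0 \<le> x" "x < T" for x
  proof -
    obtain y where "y \<in> J" "x < y" using \<open>x < T\<close> less_cSup_iff[OF _ True] z unfolding T_def by auto
    then show ?thesis using J that mem_is_interval_1_I[OF J(1), of 0 y x] by auto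
  qed
  show ?thesis
  proof (cases "T \<in> J")
    case True
    have "J = {0..T}" using True lt up J(3) by force
    then show ?thesis using T0 that(3) by auto
  next
    case False
    have "x < T" if "x \<in> J" for x using up[OF that] False that by (cases "x = T") auto
    then have "J = {0..<T}" using lt subsetD[OF J(3)] by auto
    then show ?thesis using T0 that(2) by auto
  qed
qed

section \<open>Preliminaries on derivatives, sums and the weight function\<close>

lemma Ck_on_DERIV:
  assumes "Ck_on k f A" "j < k" "x \<in> A"
  shows "((deriv ^^ j) f has_real_derivative (deriv ^^ Suc j) f x) (at x)"
  using assms by (auto simp: Ck_on_def DERIV_deriv_iff_real_differentiable)

lemma Ck_on_continuous:
  assumes "Ck_on k f A" "j \<le> k"
  shows "continuous_on A ((deriv ^^ j) f)"
proof (cases "j = k")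
  case False
  then have "((deriv ^^ j) f has_real_derivative (deriv ^^ Suc j) f x) (at x)" if "x \<in> A" for x
    using Ck_on_DERIV[OF assms(1) _ that] assms(2) by simp
  then show ?thesis
    by (intro continuous_at_imp_continuous_on ballI) (rule DERIV_isCont)
qed (use assms in \<open>auto simp: Ck_on_def\<close>)

lemma sum_shift_by_parts:
  fixes a w :: "nat \<Rightarrow> real"
  assumes "1 \<le> n"
  shows "(\<Sum>i=1..n. (a (i + 1) - a i) * w i) =
    (\<Sum>i=2..n. a i * (w (i - 1) - w i)) + a (n + 1) * w n - a 1 * w 1"
  using assms
proof (induction n rule: nat_induct_at_least)
  case base
  show ?case by (simp add: algebra_simps)
next
  case (Suc n)
  have "{2..Suc n} = insert (Suc n) {2..n}" using Suc by auto
  with Suc show ?case by (simp add: algebra_simps)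
qed

lemma beta_numerator_pos:
  fixes vm w y :: real
  assumes "0 < w" "w < vm" "0 < y" "y < vm"
  shows "0 < vm * (w + y) - 2 * w * y"
proof -
  have "0 < w * (vm - y) + y * (vm - w)" using assms by (intro add_pos_pos mult_pos_pos) auto
  then show ?thesis by (simp add: algebra_simps)
qed

lemma beta_pos:
  assumes "0 < w" "w < vm" "0 < y" "y < vm"
  shows "0 < beta vm w y"
proof -
  have "beta vm w y = vm\<^sup>2 * (vm * (w + y) - 2 * w * y) / (2 * (vm - w)\<^sup>2 * w\<^sup>2)"
    by (simp add: beta_def power3_eq_cube power2_eq_square algebra_simps)
  then show ?thesis using beta_numerator_pos[OF assms] assms by simp
qed

text \<open>
  The weight \<open>beta\<close> is the derivative in \<open>w\<close> of the penalty \<open>vm\<^sup>2 * (w - y)\<^sup>2 / (2 * w * (vm - w))\<close>,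
  divided by \<open>w - y\<close>. Clearing denominators in the formula for the acceleration therefore leaves
  precisely the combination \<open>A * (vm * (w + y) - 2 * w * y)\<close> that occurs when the weighted speed
  error is differentiated.
\<close>

lemma residual_algebra:
  fixes vm w y \<mu> f' d A :: real
  assumes w: "0 < w" "w < vm" and y: "0 < y" "y < vm"
    and A: "A = 1 / beta vm w y * ((vm\<^sup>2 * f' - \<mu> * vm\<^sup>2 * (w - y)) / (w * (vm - w)) - d)"
  shows "A * (vm * (w + y) - 2 * w * y) =
    2 * (w * (vm - w)) * f' - 2 * \<mu> * (w * (vm - w)) * (w - y) - 2 * (w * (vm - w))\<^sup>2 * d / vm\<^sup>2"
proof -
  define P N where "P = w * (vm - w)" and "N = vm * (w + y) - 2 * w * y"
  have pos: "0 < P" "0 < N" "0 < vm" using w y beta_numerator_pos[OF w y] by (auto simp: P_def N_def)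
  have "beta vm w y = vm\<^sup>2 * N / (2 * P\<^sup>2)"
    by (simp add: beta_def P_def N_def power3_eq_cube power2_eq_square algebra_simps)
  then have "A * N = 2 * P\<^sup>2 / vm\<^sup>2 * ((vm\<^sup>2 * f' - \<mu> * vm\<^sup>2 * (w - y)) / P - d)"
    using pos by (simp add: A P_def[symmetric])
  also have "\<dots> = 2 * P * f' - 2 * \<mu> * P * (w - y) - 2 * P\<^sup>2 * d / vm\<^sup>2"
    using pos by (simp add: field_simps power2_eq_square)
  finally show ?thesis by (simp add: P_def N_def)
qed

text \<open>
  The design of the feedback becomes visible in the variable \<open>q = (v - y) / sqrt (v * (vm - v))\<close>: it
  satisfies the linear equation \<open>q' = - \<mu> * q - d * sqrt (v * (vm - v)) / vm\<^sup>2\<close>. The time derivative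
  of the reference speed \<open>y\<close> cancels, and the sign of the forcing term is that of \<open>- d\<close>.
\<close>

lemma residual_has_derivative:
  fixes v y :: "real \<Rightarrow> real"
  assumes v: "(v has_real_derivative A) (at t within J)" and y: "(y has_real_derivative f') (at t within J)"
    and range: "0 < v t" "v t < vm" "0 < y t" "y t < vm"
    and A: "A = 1 / beta vm (v t) (y t) *
      ((vm\<^sup>2 * f' - \<mu> * vm\<^sup>2 * (v t - y t)) / (v t * (vm - v t)) - d)"
  shows "((\<lambda>t. (v t - y t) / sqrt (v t * (vm - v t))) has_real_derivative
    - \<mu> * ((v t - y t) / sqrt (v t * (vm - v t))) - d * sqrt (v t * (vm - v t)) / vm\<^sup>2) (at t within J)"
proof -
  define P r where "P = v t * (vm - v t)" and "r = sqrt P"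
  have pos: "0 < P" "0 < r" using range by (auto simp: P_def r_def)
  have rr: "r * r = P" using pos by (simp add: r_def)
  have "((\<lambda>t. (v t - y t) / sqrt (v t * (vm - v t))) has_real_derivative
     ((A - f') * r - (v t - y t) * (inverse r / 2 * (A * (vm - v t) - A * v t))) / (r * r)) (at t within J)"
    unfolding r_def P_def using range
    by (auto intro!: derivative_eq_intros v y simp: algebra_simps)
  moreover have "((A - f') * r - (v t - y t) * (inverse r / 2 * (A * (vm - v t) - A * v t))) / (r * r)
     = - \<mu> * ((v t - y t) / r) - d * r / vm\<^sup>2" (is "?l = ?r")
  proof -
    have "?l * (2 * r * P) = A * (2 * P - (v t - y t) * (vm - 2 * v t)) - 2 * P * f'"
      using pos by (simp add: rr[symmetric] field_simps)
    also have "2 * P - (v t - y t) * (vm - 2 * v t) = vm * (v t + y t) - 2 * v t * y t"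
      by (simp add: P_def algebra_simps)
    also have "A * \<dots> - 2 * P * f' = - 2 * \<mu> * P * (v t - y t) - 2 * P\<^sup>2 * d / vm\<^sup>2"
      using residual_algebra[OF range A] by (simp add: P_def)
    also have "\<dots> = ?r * (2 * r * P)"
      using pos range by (simp add: rr[symmetric] field_simps power2_eq_square)
    finally have "?l * (2 * r * P) = ?r * (2 * r * P)" .
    moreover have "2 * r * P \<noteq> 0" using pos by simp
    ultimately show ?thesis using mult_right_cancel by blast
  qed
  ultimately show ?thesis by (simp add: r_def P_def)
qed

text \<open>
  If \<open>w\<close> is less than half of \<open>f0\<close>, then the squared error is at least \<open>f0\<^sup>2 / 4\<close>, while the weight
  \<open>w * (vm - w)\<close> is at most \<open>w * vm\<close>; so \<open>w\<close> cannot be small.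
\<close>

lemma speed_lower_bound:
  fixes w y vm C f0 :: real
  assumes "0 < w" "w < vm" "0 < f0" "f0 \<le> y" "0 \<le> C" and res: "(w - y)\<^sup>2 \<le> C * (w * (vm - w))"
  shows "min (f0 / 2) (f0\<^sup>2 / (4 * (C * vm + 1))) \<le> w"
proof (cases "f0 / 2 \<le> w")
  case False
  have "f0\<^sup>2 / 4 = (f0 / 2)\<^sup>2" by (simp add: power2_eq_square)
  also have "\<dots> \<le> (y - w)\<^sup>2" using False assms by (intro power_mono) auto
  also have "\<dots> = (w - y)\<^sup>2" by (simp add: power2_commute)
  also have "\<dots> \<le> C * (w * (vm - w))" by (rule res)
  also have "\<dots> \<le> C * (w * vm)" using assms by (intro mult_left_mono) auto
  also have "\<dots> \<le> (C * vm + 1) * w" using assms by (simp add: algebra_simps)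
  finally have "f0\<^sup>2 \<le> w * (4 * (C * vm + 1))" by (simp add: algebra_simps)
  moreover have "0 < 4 * (C * vm + 1)" using assms by (simp add: add_nonneg_pos)
  ultimately have "f0\<^sup>2 / (4 * (C * vm + 1)) \<le> w" by (simp only: pos_divide_le_eq)
  then show ?thesis by simp
qed simp

section \<open>The closed loop and its energy\<close>

locale open_road =
  fixes n :: nat and L lam vmax vstar \<mu> :: real and V b :: "real \<Rightarrow> real"
  assumes n: "2 \<le> n" and L_lam: "L < lam" and vmax: "0 < vmax" and mu: "0 < \<mu>"
    and V_C3: "Ck_on 3 V {L<..}"
    and V_nonneg: "\<And>x. L < x \<Longrightarrow> 0 \<le> V x"
    and V_lim: "filterlim V at_top (at_right L)"
    and V_zero: "\<And>x. lam \<le> x \<Longrightarrow> V x = 0"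
    and V_deriv: "\<And>x. L < x \<Longrightarrow> x < lam \<Longrightarrow> deriv V x < 0"
    and b_range: "\<And>x. b x \<in> {vstar - vmax<..<vstar}"
    and b_C2: "Ck_on 2 b UNIV"
    and b_mono: "mono b"
    and b_0: "b 0 = 0"
    and b_sign: "\<And>x. x \<noteq> 0 \<Longrightarrow> 0 < x * b x"
begin

lemma V_DERIV:
  assumes "L < x"
  shows "(V has_real_derivative deriv V x) (at x)"
    and "(deriv V has_real_derivative deriv (deriv V) x) (at x)"
    and "(deriv (deriv V) has_real_derivative deriv (deriv (deriv V)) x) (at x)"
  using Ck_on_DERIV[OF V_C3, of 0 x] Ck_on_DERIV[OF V_C3, of 1 x] Ck_on_DERIV[OF V_C3, of 2 x] assms
  by (simp_all add: numeral_2_eq_2)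

lemma V_cont:
  "continuous_on {L<..} V" "continuous_on {L<..} (deriv V)"
  "continuous_on {L<..} (deriv (deriv V))" "continuous_on {L<..} (deriv (deriv (deriv V)))"
  using Ck_on_continuous[OF V_C3, of 0] Ck_on_continuous[OF V_C3, of 1]
    Ck_on_continuous[OF V_C3, of 2] Ck_on_continuous[OF V_C3, of 3]
  by (simp_all add: numeral_2_eq_2 numeral_3_eq_3)

lemma b_DERIV:
  "(b has_real_derivative deriv b x) (at x)"
  "(deriv b has_real_derivative deriv (deriv b) x) (at x)"
  using Ck_on_DERIV[OF b_C2, of 0 x] Ck_on_DERIV[OF b_C2, of 1 x] by simp_all

lemma b_cont: "continuous_on A b" "continuous_on A (deriv b)" "continuous_on A (deriv (deriv b))"
  using Ck_on_continuous[OF b_C2, of 0] Ck_on_continuous[OF b_C2, of 1] Ck_on_continuous[OF b_C2, of 2]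
  by (auto simp add: numeral_2_eq_2 elim: continuous_on_subset)

text \<open>
  At \<open>lam\<close> itself, where \<open>V\<close> is constant only on the right, the derivative is zero by continuity.
\<close>

lemma dV_vanishes_far: 
  assumes "lam \<le> x" shows "deriv V x = 0"
proof -
  have far: "deriv V y = 0" if "lam < y" for y
  proof -
    have "((\<lambda>_. 0) has_real_derivative deriv V y) (at y)"
      using V_DERIV(1)[of y] that L_lam
      by (rule_tac has_field_derivative_transform_within_open[of V _ y "{lam<..}"]) (auto simp: V_zero)
    then show ?thesis using DERIV_unique DERIV_const by blast
  qed
  show ?thesis
  proof (cases "x = lam")
    case True
    have "deriv V lam \<le> 0 \<and> 0 \<le> deriv V lam"
    proof -
      have c: "continuous_on (closure {lam<..}) (deriv V)"
        using V_cont(2) L_lam by (auto elim: continuous_on_subset)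
      show ?thesis
        using continuous_le_on_closure[OF c, of lam 0] continuous_ge_on_closure[OF c, of lam 0] far by auto
    qed
    then show ?thesis using True by simp
  qed (use far assms in auto)
qed

lemma dV_nonpos: "L < x \<Longrightarrow> deriv V x \<le> 0"
  using V_deriv[of x] dV_vanishes_far[of x] by (cases "x < lam") auto

abbreviation \<Omega> where "\<Omega> \<equiv> Omega_S n L vmax"
abbreviation ref where "ref \<equiv> speed_ref n V b vstar"
abbreviation acc where "acc \<equiv> accel n V b vmax vstar \<mu>"
abbreviation sol where "sol \<equiv> solution n L V b vmax vstar \<mu>"

text \<open>
  The argument of \<open>b\<close> in the reference speed of vehicle \<open>i\<close>; it is also the net repulsive force that
  the neighbours exert on that vehicle, up to sign.
\<close>

definition force_jump :: "(nat \<Rightarrow> real) \<Rightarrow> nat \<Rightarrow> real" where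
  "force_jump s i = dV n V s (i + 1) - dV n V s i"

text \<open>
  The speed error in the scale in which it obeys a linear equation. The scale degenerates at the
  speeds \<open>0\<close> and \<open>vmax\<close>, so a bound on the residual keeps the speed away from both.
\<close>

definition residual :: "(nat \<Rightarrow> real) \<Rightarrow> (nat \<Rightarrow> real) \<Rightarrow> nat \<Rightarrow> real" where
  "residual s v i = (v i - ref s i) / sqrt (v i * (vmax - v i))"

text \<open>
  Half of \<open>vmax\<^sup>2\<close> times the squared residual plays the role of a kinetic energy relative to the
  reference speed, and \<open>V\<close> that of a potential.
\<close>

definition energy :: "(nat \<Rightarrow> real) \<Rightarrow> (nat \<Rightarrow> real) \<Rightarrow> real" where
  "energy s v = (\<Sum>i=2..n. V (s i)) + vmax\<^sup>2 / 2 * (\<Sum>i=1..n. (residual s v i)\<^sup>2)"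

lemma ref_eq: "ref s i = vstar - b (force_jump s i)"
  by (simp add: speed_ref_def force_jump_def)

lemma ref_range: "0 < ref s i" "ref s i < vmax"
  using b_range[of "force_jump s i"] by (auto simp: ref_eq)

lemma OmegaD:
  assumes "(s, v) \<in> \<Omega>"
  shows "i \<in> {2..n} \<Longrightarrow> L < s i" "i \<in> {1..n} \<Longrightarrow> 0 < v i" "i \<in> {1..n} \<Longrightarrow> v i < vmax"
    "i \<notin> {2..n} \<Longrightarrow> s i = 0" "i \<notin> {1..n} \<Longrightarrow> v i = 0"
  using assms by (auto simp: Omega_S_def)

lemma dV_le_0: "(s, v) \<in> \<Omega> \<Longrightarrow> dV n V s i \<le> 0"
  using OmegaD(1)[of s v i] by (auto simp: dV_def dV_nonpos)

lemma residual_mult: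
  assumes "(s, v) \<in> \<Omega>" "i \<in> {1..n}"
  shows "residual s v i * sqrt (v i * (vmax - v i)) = v i - ref s i"
  using OmegaD(2,3)[OF assms] by (simp add: residual_def)

lemma sqrt_le_half: 
  assumes "0 < w" "w < vmax"
  shows "sqrt (w * (vmax - w)) \<le> vmax / 2"
  using arith_geo_mean_sqrt[of w "vmax - w"] assms by simp

lemma b_times_nonneg: "0 \<le> x * b x" using b_sign[of x] by (cases "x = 0") auto

lemma b_nonneg: "0 \<le> x \<Longrightarrow> 0 \<le> b x" using b_mono b_0 by (metis monoD)
lemma b_nonpos: "x \<le> 0 \<Longrightarrow> b x \<le> 0" using b_mono b_0 by (metis monoD)

context
  fixes J s v assumes sol: "sol J s v"
begin

lemma solD:
  "is_interval J" "0 \<in> J" "J \<subseteq> {0..}"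
  "t \<in> J \<Longrightarrow> (s t, v t) \<in> \<Omega>"
  "t \<in> J \<Longrightarrow> i \<in> {2..n} \<Longrightarrow> ((\<lambda>t. s t i) has_real_derivative v t (i - 1) - v t i) (at t within J)"
  "t \<in> J \<Longrightarrow> i \<in> {1..n} \<Longrightarrow> ((\<lambda>t. v t i) has_real_derivative acc (s t) (v t) i) (at t within J)"
  using sol by (auto simp: solution_def)

lemma dV_has_derivative:
  assumes "t \<in> J"
  shows "((\<lambda>t. dV n V (s t) i) has_real_derivative ddV n V (s t) i * (v t (i - 1) - v t i)) (at t within J)"
proof (cases "i \<in> {2..n}")
  case True
  then show ?thesis
    using DERIV_chain'[OF solD(5)[OF assms True] V_DERIV(2)] OmegaD(1)[OF solD(4)[OF assms] True]
    by (simp add: dV_def ddV_def)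
next
  case False
  have "(\<lambda>t. dV n V (s t) i) = (\<lambda>_. 0)" "ddV n V (s t) i = 0"
    using False by (auto simp: dV_def ddV_def)
  then show ?thesis by simp
qed

lemma ref_has_derivative:
  assumes "t \<in> J"
  shows "((\<lambda>t. ref (s t) i) has_real_derivative Z_term n V b vmax (s t) (v t) i / vmax\<^sup>2) (at t within J)"
proof -
  have "((\<lambda>t. force_jump (s t) i) has_real_derivative
      ddV n V (s t) (i + 1) * (v t i - v t (i + 1)) - ddV n V (s t) i * (v t (i - 1) - v t i)) (at t within J)"
    unfolding force_jump_def
    using DERIV_diff[OF dV_has_derivative[OF assms, of "i + 1"] dV_has_derivative[OF assms, of i]] by simp
  from DERIV_diff[OF DERIV_const DERIV_chain'[OF this b_DERIV(1)]]
  show ?thesis using vmax unfolding ref_eq by (simp add: Z_term_def force_jump_def)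
qed

lemma residual_solution_has_derivative:
  assumes t: "t \<in> J" and i: "i \<in> {1..n}"
  shows "((\<lambda>t. residual (s t) (v t) i) has_real_derivative
    - \<mu> * residual (s t) (v t) i - force_jump (s t) i * sqrt (v t i * (vmax - v t i)) / vmax\<^sup>2) (at t within J)"
  unfolding residual_def
  by (rule residual_has_derivative[OF solD(6)[OF t i] ref_has_derivative[OF t]])
    (use OmegaD(2,3)[OF solD(4)[OF t] i] ref_range vmax in
      \<open>auto simp: accel_def force_jump_def algebra_simps\<close>)

text \<open>
  The work of the potential forces cancels by summation by parts. What is left is the friction of
  the residuals and the work of the forces against the reference speeds; in the latter the constant
  part \<open>vstar\<close> drops out because the force jumps telescope to zero.
\<close>

lemma energy_has_derivative:
  assumes t: "t \<in> J"
  shows "((\<lambda>t. energy (s t) (v t)) has_real_derivative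
    - (\<mu> * vmax\<^sup>2 * (\<Sum>i=1..n. (residual (s t) (v t) i)\<^sup>2))
    - (\<Sum>i=1..n. force_jump (s t) i * b (force_jump (s t) i))) (at t within J)"
proof -
  let ?q = "\<lambda>i. residual (s t) (v t) i" and ?d = "\<lambda>i. force_jump (s t) i"
    and ?r = "\<lambda>i. sqrt (v t i * (vmax - v t i))"
  note \<Omega> = solD(4)[OF t]
  have V': "((\<lambda>t. V (s t i)) has_real_derivative dV n V (s t) i * (v t (i - 1) - v t i)) (at t within J)"
    if "i \<in> {2..n}" for i
    using DERIV_chain'[OF solD(5)[OF t that] V_DERIV(1)] OmegaD(1)[OF \<Omega> that] that by (simp add: dV_def)
  have q': "((\<lambda>t. (residual (s t) (v t) i)\<^sup>2) has_real_derivative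
      2 * ?q i * (- \<mu> * ?q i - ?d i * ?r i / vmax\<^sup>2)) (at t within J)" if "i \<in> {1..n}" for i
    using DERIV_power[OF residual_solution_has_derivative[OF t that], of 2] by (simp add: ac_simps)
  have der: "((\<lambda>t. energy (s t) (v t)) has_real_derivative
     (\<Sum>i=2..n. dV n V (s t) i * (v t (i - 1) - v t i)) +
     vmax\<^sup>2 / 2 * (\<Sum>i=1..n. 2 * ?q i * (- \<mu> * ?q i - ?d i * ?r i / vmax\<^sup>2))) (at t within J)"
    unfolding energy_def by (intro DERIV_add DERIV_sum V' DERIV_cmult q')
  have kin: "vmax\<^sup>2 / 2 * (\<Sum>i=1..n. 2 * ?q i * (- \<mu> * ?q i - ?d i * ?r i / vmax\<^sup>2))
    = (\<Sum>i=1..n. - (\<mu> * vmax\<^sup>2 * (?q i)\<^sup>2) - ?d i * v t i + vstar * ?d i - ?d i * b (?d i))"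
    unfolding sum_distrib_left
  proof (rule sum.cong[OF refl])
    fix i assume i: "i \<in> {1..n}"
    have "vmax\<^sup>2 / 2 * (2 * ?q i * (- \<mu> * ?q i - ?d i * ?r i / vmax\<^sup>2))
      = - (\<mu> * vmax\<^sup>2 * (?q i)\<^sup>2) - ?d i * (?q i * ?r i)"
      using vmax by (simp add: field_simps power2_eq_square)
    also have "\<dots> = - (\<mu> * vmax\<^sup>2 * (?q i)\<^sup>2) - ?d i * (v t i - (vstar - b (?d i)))"
      by (simp only: residual_mult[OF \<Omega> i] ref_eq)
    finally show "vmax\<^sup>2 / 2 * (2 * ?q i * (- \<mu> * ?q i - ?d i * ?r i / vmax\<^sup>2))
      = - (\<mu> * vmax\<^sup>2 * (?q i)\<^sup>2) - ?d i * v t i + vstar * ?d i - ?d i * b (?d i)"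
      by (simp add: algebra_simps)
  qed
  have parts: "(\<Sum>i=1..n. ?d i * v t i) = (\<Sum>i=2..n. dV n V (s t) i * (v t (i - 1) - v t i))"
    using sum_shift_by_parts[of n "dV n V (s t)" "v t"] n by (simp add: force_jump_def dV_def)
  have telescope: "(\<Sum>i=1..n. ?d i) = 0"
    using sum_shift_by_parts[of n "dV n V (s t)" "\<lambda>_. 1"] n by (simp add: force_jump_def dV_def)
  show ?thesis
    using der unfolding kin sum.distrib sum_subtractf sum_negf sum_distrib_left[symmetric] parts telescope
    by simp
qed

lemma energy_le_initial:
  assumes "t \<in> J"
  shows "energy (s t) (v t) \<le> energy (s 0) (v 0)"
proof (rule nonincreasing_on_interval[OF solD(1,2) assms _ energy_has_derivative])
  show "0 \<le> t" using assms solD(3) by auto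
  fix u
  have "0 \<le> \<mu> * vmax\<^sup>2 * (\<Sum>i=1..n. (residual (s u) (v u) i)\<^sup>2)"
    using mu by (intro mult_nonneg_nonneg sum_nonneg) auto
  moreover have "0 \<le> (\<Sum>i=1..n. force_jump (s u) i * b (force_jump (s u) i))"
    by (intro sum_nonneg b_times_nonneg)
  ultimately show "- (\<mu> * vmax\<^sup>2 * (\<Sum>i=1..n. (residual (s u) (v u) i)\<^sup>2))
    - (\<Sum>i=1..n. force_jump (s u) i * b (force_jump (s u) i)) \<le> 0" by simp
qed

end

lemma energy_dominates:
  assumes "(s, v) \<in> \<Omega>"
  shows "i \<in> {2..n} \<Longrightarrow> V (s i) \<le> energy s v"
    and "i \<in> {1..n} \<Longrightarrow> (residual s v i)\<^sup>2 \<le> 2 * energy s v / vmax\<^sup>2"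
    and "0 \<le> energy s v"
proof -
  have Vnn: "\<And>i. i \<in> {2..n} \<Longrightarrow> 0 \<le> V (s i)" using OmegaD(1)[OF assms] V_nonneg by auto
  have A: "0 \<le> (\<Sum>i=2..n. V (s i))" using Vnn by (rule sum_nonneg)
  have B: "0 \<le> (\<Sum>i=1..n. (residual s v i)\<^sup>2)" by (rule sum_nonneg) simp
  show "V (s i) \<le> energy s v" if "i \<in> {2..n}"
    using member_le_sum[OF that, of "\<lambda>i. V (s i)"] Vnn B unfolding energy_def
    by (simp add: add_increasing2)
  show "0 \<le> energy s v" using A B unfolding energy_def by simp
  show "(residual s v i)\<^sup>2 \<le> 2 * energy s v / vmax\<^sup>2" if "i \<in> {1..n}"
  proof -
    have "(residual s v i)\<^sup>2 \<le> (\<Sum>i=1..n. (residual s v i)\<^sup>2)"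
      using member_le_sum[OF that, of "\<lambda>i. (residual s v i)\<^sup>2"] by simp
    then have "vmax\<^sup>2 / 2 * (residual s v i)\<^sup>2 \<le> vmax\<^sup>2 / 2 * (\<Sum>i=1..n. (residual s v i)\<^sup>2)"
      by (intro mult_left_mono) auto
    then have "vmax\<^sup>2 / 2 * (residual s v i)\<^sup>2 \<le> energy s v"
      unfolding energy_def using A by linarith
    then show ?thesis using vmax by (simp add: field_simps)
  qed
qed

text \<open>
  The potential blows up at \<open>L\<close>, so a bound on the energy keeps the spacings away from \<open>L\<close>. There
  \<open>V'\<close> is bounded, hence the force jumps are, hence the reference speeds stay in a compact
  subinterval of \<open>(0, vmax)\<close>; then the bounded residuals keep the speeds in one, too. The upper
  bound on the speed \<open>w\<close> is the lower bound applied to \<open>vmax - w\<close>.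
\<close>

lemma energy_sublevel_bounds:
  assumes M: "0 \<le> M"
  obtains lo \<delta> where "L < lo" "0 < \<delta>"
    "\<And>s v i. (s, v) \<in> \<Omega> \<Longrightarrow> energy s v \<le> M \<Longrightarrow> i \<in> {2..n} \<Longrightarrow> lo \<le> s i"
    "\<And>s v i. (s, v) \<in> \<Omega> \<Longrightarrow> energy s v \<le> M \<Longrightarrow> i \<in> {1..n} \<Longrightarrow> \<delta> \<le> v i \<and> v i \<le> vmax - \<delta>"
proof -
  have "eventually (\<lambda>x. M < V x) (at_right L)"
    using V_lim by (simp add: filterlim_at_top_dense)
  then obtain lo where lo: "L < lo" "\<And>x. L < x \<Longrightarrow> x < lo \<Longrightarrow> M < V x"
    using eventually_at_right[of L "L + 1"] by auto
  have lo_le: "lo \<le> s i" if "(s, v) \<in> \<Omega>" "energy s v \<le> M" "i \<in> {2..n}" for s v i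
    using energy_dominates(1)[OF that(1,3)] that(2) OmegaD(1)[OF that(1,3)] lo(2)[of "s i"] by fastforce
  have "compact (deriv V ` {lo..lam})"
    using lo by (intro compact_continuous_image continuous_on_subset[OF V_cont(2)]) auto
  then obtain D where D: "\<And>x. x \<in> {lo..lam} \<Longrightarrow> \<bar>deriv V x\<bar> \<le> D"
    using compact_imp_bounded bounded_iff by (metis imageI real_norm_def)
  \<comment> \<open>\<open>{lo..lam}\<close> may be empty, and then \<open>D\<close> may be negative\<close>
  define D' where "D' = max D 0"
  have D': "\<bar>deriv V x\<bar> \<le> D'" if "lo \<le> x" for x
    using D[of x] dV_vanishes_far[of x] that by (cases "x \<le> lam") (auto simp: D'_def)
  define f0 f1 C where "f0 = vstar - b (2 * D')" and "f1 = vmax - (vstar - b (- 2 * D'))"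
    and "C = 2 * M / vmax\<^sup>2"
  have f_pos: "0 < f0" "0 < f1" using b_range[of "2 * D'"] b_range[of "- 2 * D'"] by (auto simp: f0_def f1_def)
  have C: "0 \<le> C" using M by (simp add: C_def)
  define \<delta> where "\<delta> = min (min (f0 / 2) (f0\<^sup>2 / (4 * (C * vmax + 1)))) (min (f1 / 2) (f1\<^sup>2 / (4 * (C * vmax + 1))))"
  have "0 < \<delta>" using f_pos C vmax by (auto simp: \<delta>_def add_nonneg_pos)
  moreover have "\<delta> \<le> v i \<and> v i \<le> vmax - \<delta>" if sv: "(s, v) \<in> \<Omega>" and H: "energy s v \<le> M" and i: "i \<in> {1..n}" for s v i
  proof -
    have "\<bar>dV n V s j\<bar> \<le> D'" for j
      using D' lo_le[OF sv H, of j] by (auto simp: dV_def D'_def)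
    from this[of i] this[of "i + 1"] have "- 2 * D' \<le> force_jump s i" "force_jump s i \<le> 2 * D'"
      by (auto simp: force_jump_def)
    then have f: "f0 \<le> ref s i" "f1 \<le> vmax - ref s i"
      using monoD[OF b_mono, of "- 2 * D'" "force_jump s i"] monoD[OF b_mono, of "force_jump s i" "2 * D'"]
      by (auto simp: f0_def f1_def ref_eq)
    note w = OmegaD(2,3)[OF sv i]
    have "(v i - ref s i)\<^sup>2 = (residual s v i)\<^sup>2 * (v i * (vmax - v i))"
      using residual_mult[OF sv i, symmetric] w by (simp add: power_mult_distrib)
    also have "\<dots> \<le> C * (v i * (vmax - v i))"
    proof (rule mult_right_mono)
      show "(residual s v i)\<^sup>2 \<le> C"
        using energy_dominates(2)[OF sv i] H vmax
        by (auto simp: C_def elim!: order_trans intro!: divide_right_mono)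
    qed (use w in simp)
    finally have res: "(v i - ref s i)\<^sup>2 \<le> C * (v i * (vmax - v i))" .
    then have res': "((vmax - v i) - (vmax - ref s i))\<^sup>2 \<le> C * ((vmax - v i) * (vmax - (vmax - v i)))"
      by (simp add: power2_commute mult.commute)
    show ?thesis
      using speed_lower_bound[OF w f_pos(1) f(1) C res] speed_lower_bound[OF _ _ f_pos(2) f(2) C res'] w
      by (auto simp: \<delta>_def)
  qed
  ultimately show ?thesis using that lo(1) lo_le by blast
qed

context
  fixes J s v assumes sol: "sol J s v"
begin

text \<open>
  With the sign condition, the forcing term of the linear equation for the residual pulls
  \<open>\<sigma> * residual\<close> down. The choices \<open>\<sigma> = 1\<close> and \<open>\<sigma> = - 1\<close> give decay of the positive and of the
  negative part of the residual.
\<close>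

lemma residual_decay:
  assumes J: "t0 \<in> J" "t \<in> J" "t0 \<le> t" and i: "i \<in> {1..n}"
    and sign: "\<And>u. u \<in> {t0<..<t} \<Longrightarrow> 0 \<le> \<sigma> * force_jump (s u) i"
  shows "\<sigma> * residual (s t) (v t) i \<le> \<sigma> * residual (s t0) (v t0) i * exp (- \<mu> * (t - t0))"
proof -
  let ?g = "\<lambda>u. \<sigma> * residual (s u) (v u) i * exp (\<mu> * (u - t0))"
  have "?g t \<le> ?g t0"
  proof (rule nonincreasing_on_interval[OF solD(1)[OF sol] J])
    fix u assume u: "u \<in> J"
    show "(?g has_real_derivative
      - (\<sigma> * force_jump (s u) i) * (sqrt (v u i * (vmax - v u i)) / vmax\<^sup>2) * exp (\<mu> * (u - t0))) (at u within J)"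
    proof -
      have "((\<lambda>u. exp (\<mu> * (u - t0))) has_real_derivative exp (\<mu> * (u - t0)) * \<mu>) (at u within J)"
        by (auto intro!: derivative_eq_intros)
      from DERIV_mult[OF DERIV_cmult[OF residual_solution_has_derivative[OF sol u i], of \<sigma>] this]
      show ?thesis by (rule DERIV_cong) (simp add: algebra_simps)
    qed
  next
    fix u assume u: "u \<in> {t0<..<t}"
    then have "u \<in> J" using mem_is_interval_1_I[OF solD(1)[OF sol] J(1,2)] by auto
    then have "0 \<le> v u i * (vmax - v u i)"
      using OmegaD(2,3)[OF solD(4)[OF sol] i, of u] by simp
    then show "- (\<sigma> * force_jump (s u) i) * (sqrt (v u i * (vmax - v u i)) / vmax\<^sup>2) * exp (\<mu> * (u - t0)) \<le> 0"
      using sign[OF u] by (simp add: mult_nonneg_nonneg)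
  qed
  then have "?g t * exp (- \<mu> * (t - t0)) \<le> \<sigma> * residual (s t0) (v t0) i * exp (- \<mu> * (t - t0))"
    by (intro mult_right_mono) auto
  then show ?thesis by (simp add: mult.assoc exp_add[symmetric])
qed

text \<open>
  The potential does not see spacings beyond \<open>lam\<close>, so the energy gives no upper bound here. But
  while the gap between the vehicles \<open>i - 1\<close> and \<open>i\<close> is at least \<open>lam\<close>, the front vehicle is only
  pushed back and the rear vehicle is only pushed forward: the force jumps have opposite signs.
  Hence the reference speed of the front vehicle is at most \<open>vstar\<close>, that of the rear vehicle at
  least \<open>vstar\<close>, and the wrong-signed parts of both residuals decay exponentially. The gap can then
  grow only by the integral of a decaying exponential.
\<close>

lemma spacing_bound_while_far:
  assumes J: "t0 \<in> J" "t \<in> J" "t0 \<le> t" and i: "i \<in> {2..n}"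
    and Q: "0 \<le> Q" "\<And>j. j \<in> {1..n} \<Longrightarrow> \<bar>residual (s t0) (v t0) j\<bar> \<le> Q"
    and far: "\<And>u. u \<in> {t0<..<t} \<Longrightarrow> lam \<le> s u i"
  shows "s t i \<le> s t0 i + vmax * Q / \<mu>"
proof -
  have i1: "i - 1 \<in> {1..n}" and i2: "i \<in> {1..n}" using i by auto
  have inJ: "u \<in> J" if "u \<in> {t0..t}" for u
    using mem_is_interval_1_I[OF solD(1)[OF sol] J(1,2)] that by auto
  have dVi: "dV n V (s u) i = 0" if "u \<in> {t0<..<t}" for u
    using far[OF that] i dV_vanishes_far by (simp add: dV_def)
  have d1: "0 \<le> force_jump (s u) (i - 1)" and d2: "force_jump (s u) i \<le> 0" if "u \<in> {t0<..<t}" for u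
    using dVi[OF that] dV_le_0[OF solD(4)[OF sol inJ]] i that by (auto simp: force_jump_def)
  let ?E = "\<lambda>u. exp (- \<mu> * (u - t0))"
  have vel: "v u (i - 1) - v u i \<le> vmax * Q * ?E u" if u: "u \<in> {t0<..<t}" for u
  proof -
    have uJ: "u \<in> J" using inJ u by auto
    note \<Omega> = solD(4)[OF sol uJ]
    have q1: "residual (s u) (v u) (i - 1) \<le> Q * ?E u"
    proof -
      have "1 * residual (s u) (v u) (i - 1) \<le> 1 * residual (s t0) (v t0) (i - 1) * ?E u"
        using u d1 by (intro residual_decay J uJ i1) auto
      also have "\<dots> \<le> Q * ?E u" using Q(2)[OF i1] by (intro mult_right_mono) auto
      finally show ?thesis by simp
    qed
    have q2: "- residual (s u) (v u) i \<le> Q * ?E u"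
    proof -
      have "- 1 * residual (s u) (v u) i \<le> - 1 * residual (s t0) (v t0) i * ?E u"
        using u d2 by (intro residual_decay J uJ i2) auto
      also have "\<dots> \<le> Q * ?E u" using Q(2)[OF i2] by (intro mult_right_mono) auto
      finally show ?thesis by simp
    qed
    have r: "0 \<le> sqrt (v u j * (vmax - v u j))" "sqrt (v u j * (vmax - v u j)) \<le> vmax / 2"
      if "j \<in> {1..n}" for j using OmegaD(2,3)[OF \<Omega> that] sqrt_le_half by auto
    have QE: "0 \<le> Q * ?E u" using Q(1) by simp
    have "v u (i - 1) - ref (s u) (i - 1) \<le> (Q * ?E u) * (vmax / 2)"
    proof -
      have "v u (i - 1) - ref (s u) (i - 1) \<le> (Q * ?E u) * sqrt (v u (i - 1) * (vmax - v u (i - 1)))"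
        unfolding residual_mult[OF \<Omega> i1, symmetric] using q1 r[OF i1] by (intro mult_right_mono)
      also have "\<dots> \<le> (Q * ?E u) * (vmax / 2)" using r[OF i1] QE by (intro mult_left_mono)
      finally show ?thesis .
    qed
    moreover have "ref (s u) i - v u i \<le> (Q * ?E u) * (vmax / 2)"
    proof -
      have "ref (s u) i - v u i = - residual (s u) (v u) i * sqrt (v u i * (vmax - v u i))"
        using residual_mult[OF \<Omega> i2] by simp
      also have "\<dots> \<le> (Q * ?E u) * sqrt (v u i * (vmax - v u i))"
        using q2 r[OF i2] by (intro mult_right_mono)
      also have "\<dots> \<le> (Q * ?E u) * (vmax / 2)" using r[OF i2] QE by (intro mult_left_mono)
      finally show ?thesis .
    qed
    moreover have "ref (s u) (i - 1) \<le> ref (s u) i"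
      using b_nonneg[OF d1[OF u]] b_nonpos[OF d2[OF u]] by (simp add: ref_eq)
    ultimately show ?thesis by (simp add: algebra_simps)
  qed
  \<comment> \<open>the added term is the integral of the velocity bound over all later times\<close>
  have "s t i + vmax * Q / \<mu> * ?E t \<le> s t0 i + vmax * Q / \<mu> * ?E t0"
  proof (rule nonincreasing_on_interval[OF solD(1)[OF sol] J])
    fix u assume u: "u \<in> J"
    show "((\<lambda>u. s u i + vmax * Q / \<mu> * ?E u) has_real_derivative
      (v u (i - 1) - v u i) - vmax * Q * ?E u) (at u within J)"
    proof -
      have "(?E has_real_derivative ?E u * - \<mu>) (at u within J)"
        by (auto intro!: derivative_eq_intros)
      from DERIV_add[OF solD(5)[OF sol u i] DERIV_cmult[OF this, of "vmax * Q / \<mu>"]]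
      show ?thesis by (rule DERIV_cong) (use mu in simp)
    qed
  next
    fix u assume "u \<in> {t0<..<t}"
    from vel[OF this] show "(v u (i - 1) - v u i) - vmax * Q * ?E u \<le> 0" by simp
  qed
  moreover have "0 \<le> vmax * Q / \<mu> * ?E t" using vmax Q mu by simp
  ultimately show ?thesis by simp
qed

text \<open>
  If the gap is larger than \<open>lam\<close> now, it has been since a last time at which it was at most \<open>lam\<close>,
  or else since time \<open>0\<close>. From then on \<open>spacing_bound_while_far\<close> applies.
\<close>

lemma spacing_bound:
  assumes t: "t \<in> J" and i: "i \<in> {2..n}" and M: "energy (s 0) (v 0) \<le> M"
  shows "s t i \<le> max lam (s 0 i) + sqrt (2 * M) / \<mu>"
proof -
  define Q where "Q = sqrt (2 * M) / vmax"
  have M0: "0 \<le> M" using energy_dominates(3)[OF solD(4)[OF sol solD(2)[OF sol]]] M by simp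
  have Q0: "0 \<le> Q" using M0 vmax by (simp add: Q_def)
  have Q: "\<bar>residual (s u) (v u) j\<bar> \<le> Q" if "u \<in> J" "j \<in> {1..n}" for u j
  proof -
    have "(residual (s u) (v u) j)\<^sup>2 \<le> 2 * energy (s u) (v u) / vmax\<^sup>2"
      by (rule energy_dominates(2)[OF solD(4)[OF sol that(1)] that(2)])
    also have "\<dots> \<le> 2 * M / vmax\<^sup>2"
      using energy_le_initial[OF sol that(1)] M by (intro divide_right_mono) auto
    also have "\<dots> = Q\<^sup>2" using M0 by (simp add: Q_def power_divide)
    finally show ?thesis using Q0 by (metis abs_le_square_iff abs_of_nonneg)
  qed
  have t0: "0 \<le> t" using t solD(3)[OF sol] by auto
  have inJ: "u \<in> J" if "u \<in> {0..t}" for u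
    using mem_is_interval_1_I[OF solD(1)[OF sol] solD(2)[OF sol] t] that by auto
  have cont: "continuous_on {0..t} (\<lambda>u. s u i)"
    by (rule continuous_on_subset[OF DERIV_continuous_on[OF solD(5)[OF sol _ i]]]) (use inJ in auto)
  have "\<exists>t0\<in>{0..t}. s t0 i \<le> max lam (s 0 i) \<and> (\<forall>u\<in>{t0<..<t}. lam \<le> s u i)"
  proof (cases "\<exists>u\<in>{0..t}. s u i \<le> lam")
    case False
    then show ?thesis using t0 by (intro bexI[of _ 0]) (auto simp: not_le less_imp_le)
  next
    case True
    define A where "A = {u \<in> {0..t}. s u i \<le> lam}"
    have "A = {0..t} \<inter> (\<lambda>u. s u i) -` {..lam}" by (auto simp: A_def)
    then have "closed A" using continuous_closed_preimage[OF cont] by simp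
    moreover have "bounded A"
      by (rule bounded_subset[OF bounded_closed_interval[of 0 t]]) (auto simp: A_def)
    ultimately have "compact A" by (simp add: compact_eq_bounded_closed)
    moreover have "A \<noteq> {}" using True by (auto simp: A_def)
    ultimately obtain a where a: "a \<in> A" "\<And>u. u \<in> A \<Longrightarrow> u \<le> a"
      using compact_attains_sup[of A] by blast
    show ?thesis
    proof (intro bexI[of _ a] conjI ballI)
      fix u assume u: "u \<in> {a<..<t}"
      have "u \<notin> A" using a(2)[of u] u by auto
      moreover have "u \<in> {0..t}" using a(1) u by (auto simp: A_def)
      ultimately show "lam \<le> s u i" by (auto simp: A_def)
    qed (use a(1) in \<open>auto simp: A_def\<close>)
  qed
  then obtain t0 where *: "t0 \<in> {0..t}" "s t0 i \<le> max lam (s 0 i)" "\<And>u. u \<in> {t0<..<t} \<Longrightarrow> lam \<le> s u i"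
    by auto
  have "s t i \<le> s t0 i + vmax * Q / \<mu>"
    using * Q0 Q inJ t i by (intro spacing_bound_while_far) auto
  also have "vmax * Q = sqrt (2 * M)" using vmax by (simp add: Q_def)
  finally show ?thesis using *(2) by simp
qed

end

end

section \<open>Local solutions of the closed loop\<close>

instance bcontfun :: (metric_space, banach) banach ..

text \<open>
  The local existence theorem needs the states to form one Banach space for all \<open>n\<close>; pairs of
  bounded sequences, each with the supremum norm, serve this purpose. The discrete copy of \<open>nat\<close>
  supplies the metric on the index set that the completeness of the function space asks for.
\<close>

type_synonym ell_infty = "nat discrete \<Rightarrow>\<^sub>C real"

definition to_ell_infty :: "(nat \<Rightarrow> real) \<Rightarrow> ell_infty" where
  "to_ell_infty g = Bcontfun (\<lambda>x. g (of_discrete x))"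

definition spacings :: "ell_infty \<times> ell_infty \<Rightarrow> nat \<Rightarrow> real" where
  "spacings z i = apply_bcontfun (fst z) (discrete i)"

definition speeds :: "ell_infty \<times> ell_infty \<Rightarrow> nat \<Rightarrow> real" where
  "speeds z i = apply_bcontfun (snd z) (discrete i)"

lemma apply_to_ell_infty:
  fixes g :: "nat \<Rightarrow> real"
  assumes "finite I" "\<And>i. i \<notin> I \<Longrightarrow> g i = 0"
  shows "apply_bcontfun (to_ell_infty g) x = g (of_discrete x)"
proof -
  have "range (\<lambda>x. g (of_discrete x)) \<subseteq> insert 0 (g ` I)" using assms(2) by auto
  then have "bounded (range (\<lambda>x. g (of_discrete x)))"
    using assms(1) by (meson finite_imageI finite_imp_bounded finite_insert finite_subset)
  moreover have "continuous_on UNIV (\<lambda>x. g (of_discrete x))"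
    by (simp add: continuous_on_open_vimage open_discrete)
  ultimately have "apply_bcontfun (Bcontfun (\<lambda>x. g (of_discrete x))) = (\<lambda>x. g (of_discrete x))"
    by (intro Bcontfun_inverse) (simp add: bcontfun_def)
  then show ?thesis by (simp add: to_ell_infty_def)
qed

lemma apply_to_ell_infty_if:
  fixes g :: "nat \<Rightarrow> real"
  assumes "finite I"
  shows "apply_bcontfun (to_ell_infty (\<lambda>i. if i \<in> I then g i else 0)) x =
    (if of_discrete x \<in> I then g (of_discrete x) else 0)"
  by (subst apply_to_ell_infty[OF assms]) auto

lemma lipschitz_coordinate:
  "1-lipschitz_on A (\<lambda>z. spacings z i)" "1-lipschitz_on A (\<lambda>z. speeds z i)"
proof -
  have "dist (spacings z i) (spacings w i) \<le> 1 * dist z w" for z w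
    using dist_bounded[of "fst z" "discrete i" "fst w"] dist_fst_le[of z w] by (simp add: spacings_def)
  moreover have "dist (speeds z i) (speeds w i) \<le> 1 * dist z w" for z w
    using dist_bounded[of "snd z" "discrete i" "snd w"] dist_snd_le[of z w] by (simp add: speeds_def)
  ultimately show "1-lipschitz_on A (\<lambda>z. spacings z i)" "1-lipschitz_on A (\<lambda>z. speeds z i)"
    by (auto intro!: lipschitz_onI)
qed

lemmas lipschitz_near_coordinate = lipschitz_coordinate[THEN lipschitz_on_imp_near]

lemma lipschitz_near_finite_support:
  fixes g :: "'a::metric_space \<Rightarrow> nat \<Rightarrow> real"
  assumes I: "finite I" and g: "\<And>i. i \<in> I \<Longrightarrow> lipschitz_near (\<lambda>z. g z i) x"
  shows "lipschitz_near (\<lambda>z. to_ell_infty (\<lambda>i. if i \<in> I then g z i else 0)) x"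
proof -
  have "\<exists>e>0. \<exists>C. \<forall>i\<in>I. C-lipschitz_on (cball x e) (\<lambda>z. g z i)"
    using I g
  proof (induction I rule: finite_induct)
    case empty
    then show ?case by (auto intro: exI[of _ 1])
  next
    case (insert j I)
    then obtain e C where 1: "0 < e" "\<And>i. i \<in> I \<Longrightarrow> C-lipschitz_on (cball x e) (\<lambda>z. g z i)"
      by auto
    obtain e' C' where 2: "0 < e'" "C'-lipschitz_on (cball x e') (\<lambda>z. g z j)"
      using insert.prems[of j] by (auto simp: lipschitz_near_def)
    have "(max C C')-lipschitz_on (cball x (min e e')) (\<lambda>z. g z i)" if "i \<in> insert j I" for i
      using that 1(2)[of i] 2(2) by (auto elim!: lipschitz_on_mono)
    then show ?case using 1(1) 2(1) by (intro exI[of _ "min e e'"]) auto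
  qed
  then obtain e C where e: "0 < e" "\<And>i. i \<in> I \<Longrightarrow> C-lipschitz_on (cball x e) (\<lambda>z. g z i)" by auto
  have "\<bar>C\<bar>-lipschitz_on (cball x e) (\<lambda>z. to_ell_infty (\<lambda>i. if i \<in> I then g z i else 0))"
  proof (intro lipschitz_onI dist_bound)
    fix y z and k :: "nat discrete" assume yz: "y \<in> cball x e" "z \<in> cball x e"
    have "dist (g y i) (g z i) \<le> \<bar>C\<bar> * dist y z" if "i \<in> I" for i
      using lipschitz_onD[OF e(2)[OF that] yz] lipschitz_on_nonneg[OF e(2)[OF that]] by simp
    then show "dist (apply_bcontfun (to_ell_infty (\<lambda>i. if i \<in> I then g y i else 0)) k)
        (apply_bcontfun (to_ell_infty (\<lambda>i. if i \<in> I then g z i else 0)) k) \<le> \<bar>C\<bar> * dist y z"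
      using I by (simp add: apply_to_ell_infty_if)
  qed simp
  then show ?thesis using e(1) by (auto simp: lipschitz_near_def)
qed

lemma zero_psubset_Icc: "0 < c \<Longrightarrow> {0} \<subset> {0..c}" for c :: real
proof -
  assume c: "0 < c"
  then have "c \<in> {0..c}" "c \<notin> {0}" by auto
  then have "{0} \<noteq> {0..c}" by metis
  then show ?thesis using c by (intro psubsetI) auto
qed

lemma solution_append:
  assumes s1: "solution n L V b vmax vstar \<mu> {0..T} s v" and s2: "solution n L V b vmax vstar \<mu> {0..h} s' v'"
    and T: "0 < T" "0 < h" and eq: "s' 0 = s T" "v' 0 = v T"
  shows "solution n L V b vmax vstar \<mu> {0..T + h}
    (\<lambda>t. if t \<le> T then s t else s' (t - T)) (\<lambda>t. if t \<le> T then v t else v' (t - T))"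
proof -
  let ?s = "\<lambda>t. if t \<le> T then s t else s' (t - T)" and ?v = "\<lambda>t. if t \<le> T then v t else v' (t - T)"
  have shift: "((\<lambda>t. g (t - T)) has_real_derivative D) (at t within {T..T + h})"
    if "(g has_real_derivative D) (at (t - T) within {0..h})" for g D and t :: real
  proof -
    have "(\<lambda>t. t - T) ` {T..T + h} = {0..h}" by (auto simp: image_iff intro: bexI[of _ "_ + T"])
    moreover have "((\<lambda>t. t - T) has_real_derivative 1) (at t within {T..T + h})"
      by (auto intro!: derivative_eq_intros)
    ultimately show ?thesis
      using DERIV_image_chain[of g D "\<lambda>t. t - T" t "{T..T + h}" 1] that by (simp add: o_def)
  qed
  have glue: "((\<lambda>t. if t \<le> T then f t else g (t - T)) has_real_derivative
      (if t \<le> T then \<phi> t else \<psi> (t - T))) (at t within {0..T + h})"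
    if "\<And>t. t \<in> {0..T} \<Longrightarrow> (f has_real_derivative \<phi> t) (at t within {0..T})"
      "\<And>t. t \<in> {0..h} \<Longrightarrow> (g has_real_derivative \<psi> t) (at t within {0..h})"
      "f T = g 0" "\<phi> T = \<psi> 0" "t \<in> {0..T + h}" for f g \<phi> \<psi> t
    by (rule has_real_derivative_glue[of 0 T "T + h" f \<phi> "\<lambda>t. g (t - T)" "\<lambda>t. \<psi> (t - T)"])
      (use that T shift in auto)
  have 1: "((\<lambda>t. ?s t i) has_real_derivative ?v t (i - 1) - ?v t i) (at t within {0..T + h})"
    if "i \<in> {2..n}" "t \<in> {0..T + h}" for i t
    using glue[of "\<lambda>t. s t i" "\<lambda>t. v t (i - 1) - v t i" "\<lambda>t. s' t i" "\<lambda>t. v' t (i - 1) - v' t i" t]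
      s1 s2 that eq by (simp add: solution_def if_distribR if_distrib cong: if_cong split: if_splits)
  have 2: "((\<lambda>t. ?v t i) has_real_derivative accel n V b vmax vstar \<mu> (?s t) (?v t) i) (at t within {0..T + h})"
    if "i \<in> {1..n}" "t \<in> {0..T + h}" for i t
    using glue[of "\<lambda>t. v t i" "\<lambda>t. accel n V b vmax vstar \<mu> (s t) (v t) i"
        "\<lambda>t. v' t i" "\<lambda>t. accel n V b vmax vstar \<mu> (s' t) (v' t) i" t]
      s1 s2 that eq by (simp add: solution_def if_distribR if_distrib cong: if_cong split: if_splits)
  have 3: "(?s t, ?v t) \<in> Omega_S n L vmax" if "t \<in> {0..T + h}" for t
    using s1 s2 that by (auto simp: solution_def)
  have "{0} \<subset> {0..T + h}" using T by (intro zero_psubset_Icc) simp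
  then show ?thesis
    using 1 2 3 unfolding solution_def by (simp add: is_interval_cc)
qed

context open_road begin

lemma accel_denominators:
  assumes "(s, v) \<in> \<Omega>" "i \<in> {1..n}"
  shows "v i * (vmax - v i) \<noteq> 0" "beta vmax (v i) (ref s i) \<noteq> 0" "2 * (vmax - v i)\<^sup>2 * (v i)\<^sup>2 \<noteq> 0"
  using OmegaD(2,3)[OF assms] beta_pos[of "v i" vmax "ref s i"] ref_range[of s i] by auto

lemma accel_lipschitz_near:
  assumes z: "(spacings z, speeds z) \<in> \<Omega>" and i: "i \<in> {1..n}"
  shows "lipschitz_near (\<lambda>z. acc (spacings z) (speeds z) i) z"
proof -
  note c = lipschitz_near_coordinate
  have V1: "lipschitz_near (deriv V) x" and V2: "lipschitz_near (deriv (deriv V)) x" if "L < x" for x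
    using that V_DERIV V_cont
    by (auto intro!: C1_imp_lipschitz_near[of "{L<..}" x "deriv V" "deriv (deriv V)"]
      C1_imp_lipschitz_near[of "{L<..}" x "deriv (deriv V)" "deriv (deriv (deriv V))"])
  have b0: "lipschitz_near b x" and b1: "lipschitz_near (deriv b) x" for x
    by (auto intro!: C1_imp_lipschitz_near[of UNIV x b "deriv b"]
      C1_imp_lipschitz_near[of UNIV x "deriv b" "deriv (deriv b)"] b_DERIV b_cont)
  have dV: "lipschitz_near (\<lambda>z. dV n V (spacings z) j) z" for j
    using OmegaD(1)[OF z, of j] lipschitz_near_compose[OF V1 c(1)]
    by (cases "j \<in> {2..n}") (simp_all add: dV_def lipschitz_near_const del: atLeastAtMost_iff)
  have ddV: "lipschitz_near (\<lambda>z. ddV n V (spacings z) j) z" for j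
    using OmegaD(1)[OF z, of j] lipschitz_near_compose[OF V2 c(1)]
    by (cases "j \<in> {2..n}") (simp_all add: ddV_def lipschitz_near_const del: atLeastAtMost_iff)
  have jump: "lipschitz_near (\<lambda>z. dV n V (spacings z) (j + 1) - dV n V (spacings z) j) z" for j
    by (intro lipschitz_near_diff dV)
  have ref: "lipschitz_near (\<lambda>z. ref (spacings z) j) z" for j
    unfolding speed_ref_def
    by (intro lipschitz_near_diff lipschitz_near_const lipschitz_near_compose[OF b0 jump])
  have Z: "lipschitz_near (\<lambda>z. Z_term n V b vmax (spacings z) (speeds z) j) z" for j
    unfolding Z_term_def
    by (intro lipschitz_near_mult lipschitz_near_diff lipschitz_near_const ddV c
      lipschitz_near_compose[OF b1 jump])
  have beta: "lipschitz_near (\<lambda>z. beta vmax (speeds z i) (ref (spacings z) i)) z"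
    unfolding beta_def
    by (intro lipschitz_near_divide lipschitz_near_diff lipschitz_near_mult lipschitz_near_add
      lipschitz_near_power lipschitz_near_const ref c accel_denominators(3)[OF z i])
  show ?thesis
    unfolding accel_def
    by (intro lipschitz_near_divide lipschitz_near_diff lipschitz_near_mult lipschitz_near_add
      lipschitz_near_const ref dV Z beta c accel_denominators[OF z i])
qed

text \<open>
  The vector field is set to zero in the components that are not part of the state. The solution
  then keeps these components equal to \<open>0\<close>, as membership in the state space demands.
\<close>

lemma local_solution:
  assumes x0: "(s0, v0) \<in> \<Omega>"
  obtains h s v where "0 < h" "sol {0..h} s v" "s 0 = s0" "v 0 = v0"
proof -
  define z0 where "z0 = (to_ell_infty s0, to_ell_infty v0)"
  have z0: "spacings z0 = s0" "speeds z0 = v0"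
    using OmegaD(4,5)[OF x0] apply_to_ell_infty[of "{2..n}" s0] apply_to_ell_infty[of "{1..n}" v0]
    by (simp_all add: z0_def spacings_def speeds_def discrete_inverse fun_eq_iff del: atLeastAtMost_iff)
  define F where "F = (\<lambda>z. (to_ell_infty (\<lambda>i. if i \<in> {2..n} then speeds z (i - 1) - speeds z i else 0),
    to_ell_infty (\<lambda>i. if i \<in> {1..n} then acc (spacings z) (speeds z) i else 0)))"
  have posF: "spacings (F z) i = (if i \<in> {2..n} then speeds z (i - 1) - speeds z i else 0)"
    and velF: "speeds (F z) i = (if i \<in> {1..n} then acc (spacings z) (speeds z) i else 0)" for z i
    using apply_to_ell_infty_if[of "{2..n}" "\<lambda>i. speeds z (i - 1) - speeds z i" "discrete i"]
      apply_to_ell_infty_if[of "{1..n}" "acc (spacings z) (speeds z)" "discrete i"]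
    by (simp_all add: F_def spacings_def[of "(_, _)"] speeds_def[of "(_, _)"] discrete_inverse)
  have "lipschitz_near F z0"
    unfolding F_def using x0 z0
    by (intro lipschitz_near_Pair lipschitz_near_finite_support lipschitz_near_diff
      lipschitz_near_coordinate accel_lipschitz_near) auto
  then obtain e C where e: "0 < e" "C-lipschitz_on (cball z0 e) F" by (auto simp: lipschitz_near_def)
  \<comment> \<open>the strict inequalities are an open condition, unlike the zero entries of a state\<close>
  define U where "U = (\<Inter>i\<in>{2..n}. {z. L < spacings z i}) \<inter> (\<Inter>i\<in>{1..n}. {z. 0 < speeds z i} \<inter> {z. speeds z i < vmax})"
  have "open U"
    unfolding U_def
    by (intro open_Int open_INT ballI open_Collect_less continuous_on_const
        lipschitz_on_continuous_on[OF lipschitz_coordinate(1)]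
        lipschitz_on_continuous_on[OF lipschitz_coordinate(2)]) auto
  moreover have "z0 \<in> U" using x0 by (auto simp: U_def z0 Omega_S_def)
  ultimately obtain d where d: "0 < d" "cball z0 d \<subseteq> U" using open_contains_cball by blast
  have "C-lipschitz_on (cball z0 (min d e)) F"
    using e(2) by (rule lipschitz_on_subset) auto
  then obtain h x where h: "0 < h" "x 0 = z0" "\<And>t. t \<in> {0..h} \<Longrightarrow> x t \<in> cball z0 (min d e)"
    "\<And>t. t \<in> {0..h} \<Longrightarrow> (x has_vector_derivative F (x t)) (at t within {0..h})"
    using picard_lindelof_autonomous[of "min d e" C z0 F] d(1) e(1) by auto
  have blp: "bounded_linear (\<lambda>z. spacings z i)" and blv: "bounded_linear (\<lambda>z. speeds z i)" for i
  proof -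
    have "\<bar>spacings z i\<bar> \<le> norm z" "\<bar>speeds z i\<bar> \<le> norm z" for z
      using norm_bounded[of "fst z" "discrete i"] norm_fst_le[of "fst z" "snd z"]
        norm_bounded[of "snd z" "discrete i"] norm_snd_le[of "snd z" "fst z"]
      by (simp_all add: spacings_def speeds_def)
    then show "bounded_linear (\<lambda>z. spacings z i)" "bounded_linear (\<lambda>z. speeds z i)"
      by (auto intro!: bounded_linear_intro[of _ 1] simp: spacings_def speeds_def)
  qed
  have derp: "((\<lambda>t. spacings (x t) i) has_real_derivative spacings (F (x t)) i) (at t within {0..h})"
    and derv: "((\<lambda>t. speeds (x t) i) has_real_derivative speeds (F (x t)) i) (at t within {0..h})"
    if "t \<in> {0..h}" for t i
    using bounded_linear.has_vector_derivative[OF blp h(4)[OF that]]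
      bounded_linear.has_vector_derivative[OF blv h(4)[OF that]]
    by (simp_all add: has_real_derivative_iff_has_vector_derivative)
  have const: "g t = g 0" if "t \<in> {0..h}" "\<And>t. t \<in> {0..h} \<Longrightarrow> (g has_real_derivative 0) (at t within {0..h})"
    for g :: "real \<Rightarrow> real" and t
    using has_field_derivative_zero_constant[of "{0..h}" g] that by fastforce
  have "(spacings (x t), speeds (x t)) \<in> \<Omega>" if t: "t \<in> {0..h}" for t
  proof -
    have "x t \<in> U" using h(3)[OF t] d(2) by auto
    moreover have "spacings (x t) i = 0" if i: "i \<notin> {2..n}" for i
      using const[OF t derp[of _ i, unfolded posF if_not_P[OF i]]] OmegaD(4)[OF x0 i]
      by (simp only: h(2) z0)
    moreover have "speeds (x t) i = 0" if i: "i \<notin> {1..n}" for i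
      using const[OF t derv[of _ i, unfolded velF if_not_P[OF i]]] OmegaD(5)[OF x0 i]
      by (simp only: h(2) z0)
    ultimately show ?thesis by (auto simp: U_def Omega_S_def)
  qed
  moreover have "((\<lambda>t. spacings (x t) i) has_real_derivative speeds (x t) (i - 1) - speeds (x t) i) (at t within {0..h})"
    if "t \<in> {0..h}" "i \<in> {2..n}" for t i
    using derp[OF that(1), of i] unfolding posF if_P[OF that(2)] .
  moreover have "((\<lambda>t. speeds (x t) i) has_real_derivative acc (spacings (x t)) (speeds (x t)) i) (at t within {0..h})"
    if "t \<in> {0..h}" "i \<in> {1..n}" for t i
    using derv[OF that(1), of i] unfolding velF if_P[OF that(2)] .
  moreover have "{0} \<subset> {0..h}" using h(1) by (rule zero_psubset_Icc)
  ultimately have "sol {0..h} (\<lambda>t. spacings (x t)) (\<lambda>t. speeds (x t))"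
    unfolding solution_def by (simp add: is_interval_cc)
  then show ?thesis using that[OF h(1)] z0 h(2) by simp
qed

section \<open>Continuation and the uniform compact set\<close>

lemma continuous_coordinate:
  "continuous_on A (\<lambda>z :: state. fst z i)" "continuous_on A (\<lambda>z :: state. snd z i)"
  by (rule continuous_on_compose2[OF continuous_on_product_coordinates continuous_on_fst[OF continuous_on_id]], simp)
    (rule continuous_on_compose2[OF continuous_on_product_coordinates continuous_on_snd[OF continuous_on_id]], simp)

lemma
  shows accel_continuous: "i \<in> {1..n} \<Longrightarrow> continuous_on \<Omega> (\<lambda>z. acc (fst z) (snd z) i)"
    and energy_continuous: "continuous_on \<Omega> (\<lambda>z. energy (fst z) (snd z))"
proof -
  note c = continuous_coordinate
  have \<Omega>: "(fst z, snd z) \<in> \<Omega>" if "z \<in> \<Omega>" for z using that by simp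
  have static: "continuous_on \<Omega> (\<lambda>z. g (fst z j))" if "continuous_on {L<..} g" "j \<in> {2..n}" for g :: "real \<Rightarrow> real" and j
    using OmegaD(1)[OF \<Omega> that(2)] by (intro continuous_on_compose2[OF that(1) c(1)]) auto
  have dV: "continuous_on \<Omega> (\<lambda>z. dV n V (fst z) j)" for j
    using static[OF V_cont(2)] by (cases "j \<in> {2..n}") (simp_all add: dV_def del: atLeastAtMost_iff)
  have ddV: "continuous_on \<Omega> (\<lambda>z. ddV n V (fst z) j)" for j
    using static[OF V_cont(3)] by (cases "j \<in> {2..n}") (simp_all add: ddV_def del: atLeastAtMost_iff)
  have jump: "continuous_on \<Omega> (\<lambda>z. dV n V (fst z) (j + 1) - dV n V (fst z) j)" for j
    by (intro continuous_on_diff dV)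
  have ref: "continuous_on \<Omega> (\<lambda>z. ref (fst z) j)" for j
    unfolding speed_ref_def
    by (intro continuous_on_diff continuous_on_const continuous_on_compose2[OF b_cont(1)[of UNIV] jump]) auto
  have Z: "continuous_on \<Omega> (\<lambda>z. Z_term n V b vmax (fst z) (snd z) j)" for j
    unfolding Z_term_def
    by (intro continuous_on_mult continuous_on_diff continuous_on_const ddV c
      continuous_on_compose2[OF b_cont(2)[of UNIV] jump]) auto
  show "continuous_on \<Omega> (\<lambda>z. acc (fst z) (snd z) i)" if i: "i \<in> {1..n}"
  proof -
    have beta: "continuous_on \<Omega> (\<lambda>z. beta vmax (snd z i) (ref (fst z) i))"
      unfolding beta_def
      by (intro continuous_intros ref c ballI accel_denominators(3)[OF \<Omega> i])
    show ?thesis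
      unfolding accel_def
      by (intro continuous_on_divide continuous_on_mult continuous_on_add continuous_on_diff continuous_on_const
        beta ref dV Z c ballI accel_denominators[OF \<Omega> i])
  qed
  have "continuous_on \<Omega> (\<lambda>z. residual (fst z) (snd z) i)" if i: "i \<in> {1..n}" for i
    unfolding residual_def using accel_denominators(1)[OF \<Omega> i]
    by (intro continuous_intros ref c) auto
  then show "continuous_on \<Omega> (\<lambda>z. energy (fst z) (snd z))"
    unfolding energy_def by (intro continuous_intros static[OF V_cont(1)]) auto
qed

text \<open>
  A solution in a compact set has bounded velocity, so all components have limits at the end of the
  time interval; the limit lies in the compact set and hence in the domain of the vector field.
\<close>

lemma solution_extends_to_closed:
  assumes sol: "sol {0..<T} s v" and T: "0 < T" and K: "compact K" "K \<subseteq> \<Omega>"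
    and inK: "\<And>t. t \<in> {0..<T} \<Longrightarrow> (s t, v t) \<in> K"
  obtains s' v' where "sol {0..T} s' v'" "\<And>t. t \<in> {0..<T} \<Longrightarrow> s' t = s t \<and> v' t = v t"
proof -
  have bnd: "\<exists>B. \<forall>t\<in>{0..<T}. \<bar>acc (s t) (v t) i\<bar> \<le> B" if "i \<in> {1..n}" for i
  proof -
    have "compact ((\<lambda>z. acc (fst z) (snd z) i) ` K)"
      using accel_continuous[OF that] K by (intro compact_continuous_image) (auto elim: continuous_on_subset)
    then obtain B where "\<forall>y\<in>(\<lambda>z. acc (fst z) (snd z) i) ` K. norm y \<le> B"
      using compact_imp_bounded bounded_iff by metis
    then show ?thesis using inK by (intro exI[of _ B]) force
  qed
  have "\<exists>l. continuous_on {0..T} (\<lambda>t. if t < T then s t i else l)" for i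
  proof (cases "i \<in> {2..n}")
    case True
    then have "i \<in> {1..n}" "i - 1 \<in> {1..n}" by auto
    then have "\<bar>v t (i - 1) - v t i\<bar> \<le> vmax" if "t \<in> {0..<T}" for t
      using OmegaD(2,3)[OF solD(4)[OF sol that], of i] OmegaD(2,3)[OF solD(4)[OF sol that], of "i - 1"] by fastforce
    then show ?thesis
      by (metis bounded_derivative_left_limit[OF T solD(5)[OF sol _ True]])
  next
    case False
    have "continuous_on {0..T} (\<lambda>t. if t < T then s t i else 0)"
      using OmegaD(4)[OF solD(4)[OF sol] False] by (subst continuous_on_cong[OF refl, of _ _ "\<lambda>_. 0"]) auto
    then show ?thesis by blast
  qed
  then obtain ls where ls: "\<And>i. continuous_on {0..T} (\<lambda>t. if t < T then s t i else ls i)" by metis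
  have "\<exists>l. continuous_on {0..T} (\<lambda>t. if t < T then v t i else l)" for i
  proof (cases "i \<in> {1..n}")
    case True
    then show ?thesis
      by (metis bnd[OF True] bounded_derivative_left_limit[OF T solD(6)[OF sol _ True]])
  next
    case False
    have "continuous_on {0..T} (\<lambda>t. if t < T then v t i else 0)"
      using OmegaD(5)[OF solD(4)[OF sol] False] by (subst continuous_on_cong[OF refl, of _ _ "\<lambda>_. 0"]) auto
    then show ?thesis by blast
  qed
  then obtain lv where lv: "\<And>i. continuous_on {0..T} (\<lambda>t. if t < T then v t i else lv i)" by metis
  define s' where "s' = (\<lambda>t. if t < T then s t else ls)"
  define v' where "v' = (\<lambda>t. if t < T then v t else lv)"
  have cs: "continuous_on {0..T} (\<lambda>t. s' t i)" and cv: "continuous_on {0..T} (\<lambda>t. v' t i)" for i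
    using ls[of i] lv[of i] by (simp_all add: s'_def v'_def if_distribR)
  have cz: "continuous_on {0..T} (\<lambda>t. (s' t, v' t))"
    by (intro continuous_on_Pair continuous_on_coordinatewise_then_product cs cv)
  have "(\<lambda>t. (s' t, v' t)) ` closure {0..<T} \<subseteq> K"
    using cz T K(1) inK by (intro image_closure_subset) (auto simp: compact_imp_closed s'_def v'_def)
  then have K': "(s' t, v' t) \<in> K" if "t \<in> {0..T}" for t using that T by auto
  have at_interior: "(g' has_real_derivative D) (at t)"
    if "(g has_real_derivative D) (at t within {0..<T})" "t \<in> {0<..<T}" "\<And>t. t < T \<Longrightarrow> g' t = g t" for g g' D and t :: real
  proof -
    have "(g has_real_derivative D) (at t)"
      using that(1,2) at_within_interior[of t "{0..<T}"] by simp
    then show ?thesis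
      by (rule has_field_derivative_transform_within_open[of _ _ _ "{0<..<T}"]) (use that in auto)
  qed
  have 1: "((\<lambda>t. s' t i) has_real_derivative v' t (i - 1) - v' t i) (at t within {0..T})"
    if "t \<in> {0..T}" "i \<in> {2..n}" for t i
  proof (rule derivative_extends_to_endpoints[OF cs continuous_on_diff[OF cv cv] _ that(1)])
    fix t assume t: "t \<in> {0<..<T}"
    show "((\<lambda>t. s' t i) has_real_derivative v' t (i - 1) - v' t i) (at t)"
      by (rule at_interior[of "\<lambda>t. s t i"]) (use solD(5)[OF sol, of t i] t that in \<open>auto simp: s'_def v'_def\<close>)
  qed
  have 2: "((\<lambda>t. v' t i) has_real_derivative acc (s' t) (v' t) i) (at t within {0..T})"
    if "t \<in> {0..T}" "i \<in> {1..n}" for t i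
  proof (rule derivative_extends_to_endpoints[OF cv _ _ that(1)])
    show "continuous_on {0..T} (\<lambda>t. acc (s' t) (v' t) i)"
    proof -
      have "(\<lambda>t. (s' t, v' t)) ` {0..T} \<subseteq> \<Omega>" using K' K(2) by auto
      from continuous_on_compose2[OF accel_continuous[OF that(2)] cz this] show ?thesis by simp
    qed
    fix t assume t: "t \<in> {0<..<T}"
    show "((\<lambda>t. v' t i) has_real_derivative acc (s' t) (v' t) i) (at t)"
      by (rule at_interior[of "\<lambda>t. v t i"]) (use solD(6)[OF sol, of t i] t that in \<open>auto simp: s'_def v'_def\<close>)
  qed
  have "{0} \<subset> {0..T}" using T by (rule zero_psubset_Icc)
  then have "sol {0..T} s' v'"
    unfolding solution_def using 1 2 K' K(2) by (auto simp: is_interval_cc)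
  then show ?thesis by (rule that) (simp add: s'_def v'_def)
qed

lemma compact_box:
  "compact {(s :: nat \<Rightarrow> real, v). (\<forall>i. s i \<in> (if i \<in> {2..n} then {lo..hi} else {0})) \<and>
     (\<forall>i. v i \<in> (if i \<in> {1..n} then {\<delta>..vmax - \<delta>} else {0 :: real}))}" (is "compact ?K")
proof -
  have box: "compact {x :: nat \<Rightarrow> real. \<forall>i. x i \<in> A i}" if "\<And>i. compact (A i)" for A :: "nat \<Rightarrow> real set"
  proof -
    have "compactin (product_topology (\<lambda>_. euclidean) UNIV) (PiE UNIV A)"
      using that by (simp add: compactin_PiE)
    moreover have "PiE UNIV A = {x. \<forall>i. x i \<in> A i}" by auto
    ultimately show ?thesis by (simp add: euclidean_product_topology)
  qed
  have "?K = {s. \<forall>i. s i \<in> (if i \<in> {2..n} then {lo..hi} else {0})} \<times>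
      {v. \<forall>i. v i \<in> (if i \<in> {1..n} then {\<delta>..vmax - \<delta>} else {0})}" by auto
  then show ?thesis by (simp only:) (intro compact_Times box, auto)
qed

lemma initial_bounds:
  assumes S: "compact S" "S \<subseteq> \<Omega>"
  obtains M A where "0 \<le> M" "\<And>s v. (s, v) \<in> S \<Longrightarrow> energy s v \<le> M"
    "\<And>s v i. (s, v) \<in> S \<Longrightarrow> i \<in> {2..n} \<Longrightarrow> s i \<le> A"
proof -
  have bnd: "\<exists>B. \<forall>z\<in>S. \<bar>g z\<bar> \<le> B" if "continuous_on \<Omega> g" for g :: "state \<Rightarrow> real"
  proof -
    have "compact (g ` S)" using that S by (intro compact_continuous_image) (auto elim: continuous_on_subset)
    then show ?thesis using compact_imp_bounded bounded_iff by (metis imageI real_norm_def)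
  qed
  obtain M where M: "\<forall>z\<in>S. \<bar>energy (fst z) (snd z)\<bar> \<le> M" using bnd[OF energy_continuous] by auto
  have "continuous_on \<Omega> (\<lambda>z. \<Sum>i=2..n. \<bar>fst z i\<bar>)" by (intro continuous_intros continuous_coordinate)
  then obtain A where A: "\<forall>z\<in>S. \<bar>\<Sum>i=2..n. \<bar>fst z i\<bar>\<bar> \<le> A" using bnd by blast
  show ?thesis
  proof (rule that[of "max M 0" A])
    fix s v assume sv: "(s, v) \<in> S"
    show "energy s v \<le> max M 0" using M sv by force
    fix i assume "i \<in> {2..n}"
    then have "\<bar>s i\<bar> \<le> (\<Sum>i=2..n. \<bar>s i\<bar>)" using member_le_sum[of i "{2..n}" "\<lambda>i. \<bar>s i\<bar>"] by auto
    then show "s i \<le> A" using A sv by force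
  qed simp
qed

text \<open>
  The box \<open>K\<close> is cut out by the bounds of the energy and the spacing estimates, which depend on the
  initial state only through its energy and spacings. A maximal solution confined to \<open>K\<close> cannot end
  at a finite time: an open end could be closed, and a closed end could be continued by a local
  solution.
\<close>

theorem uniformly_bounded_and_global:
  assumes S: "compact S" "S \<subseteq> \<Omega>"
  shows "\<exists>K. compact K \<and> K \<subseteq> \<Omega> \<and>
    (\<forall>J s v. maximal_solution n L V b vmax vstar \<mu> J s v \<and> (s 0, v 0) \<in> S \<longrightarrow>
       J = {0..} \<and> (\<forall>t\<ge>0. (s t, v t) \<in> K))"
proof -
  obtain M A where M: "0 \<le> M" "\<And>s v. (s, v) \<in> S \<Longrightarrow> energy s v \<le> M"
    and A: "\<And>s v i. (s, v) \<in> S \<Longrightarrow> i \<in> {2..n} \<Longrightarrow> s i \<le> A"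
    using initial_bounds[OF S] by metis
  obtain lo \<delta> where lo: "L < lo" "0 < \<delta>"
    "\<And>s v i. (s, v) \<in> \<Omega> \<Longrightarrow> energy s v \<le> M \<Longrightarrow> i \<in> {2..n} \<Longrightarrow> lo \<le> s i"
    "\<And>s v i. (s, v) \<in> \<Omega> \<Longrightarrow> energy s v \<le> M \<Longrightarrow> i \<in> {1..n} \<Longrightarrow> \<delta> \<le> v i \<and> v i \<le> vmax - \<delta>"
    using energy_sublevel_bounds[OF M(1)] by metis
  define hi where "hi = max lam A + sqrt (2 * M) / \<mu>"
  define K where "K = {(s, v). (\<forall>i. s i \<in> (if i \<in> {2..n} then {lo..hi} else {0})) \<and>
     (\<forall>i. v i \<in> (if i \<in> {1..n} then {\<delta>..vmax - \<delta>} else {0 :: real}))}"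
  have K: "compact K" unfolding K_def by (rule compact_box)
  have K\<Omega>: "K \<subseteq> \<Omega>"
  proof (clarify)
    fix s v assume "(s, v) \<in> K"
    then have s: "s i \<in> (if i \<in> {2..n} then {lo..hi} else {0})"
      and v: "v i \<in> (if i \<in> {1..n} then {\<delta>..vmax - \<delta>} else {0})" for i by (auto simp: K_def)
    have "i \<notin> {2..n} \<Longrightarrow> s i = 0" "i \<notin> {1..n} \<Longrightarrow> v i = 0"
      "i \<in> {2..n} \<Longrightarrow> L < s i" "i \<in> {1..n} \<Longrightarrow> 0 < v i \<and> v i < vmax" for i
      using s[of i] v[of i] lo(1,2) by (auto split: if_splits)
    then show "(s, v) \<in> \<Omega>" unfolding Omega_S_def by blast
  qed
  have inK: "(s t, v t) \<in> K" if sol: "sol J s v" and init: "(s 0, v 0) \<in> S" and t: "t \<in> J" for J s v t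
  proof -
    note \<Omega> = solD(4)[OF sol t]
    have E: "energy (s t) (v t) \<le> M" using energy_le_initial[OF sol t] M(2)[OF init] by simp
    have "s t i \<le> hi" if "i \<in> {2..n}" for i
      using spacing_bound[OF sol t that M(2)[OF init]] A[OF init that] by (auto simp: hi_def)
    then show ?thesis
      using lo(3,4)[OF \<Omega> E] OmegaD(4,5)[OF \<Omega>] by (auto simp: K_def)
  qed
  have "J = {0..} \<and> (\<forall>t\<ge>0. (s t, v t) \<in> K)"
    if max: "maximal_solution n L V b vmax vstar \<mu> J s v" and init: "(s 0, v 0) \<in> S" for J s v
  proof -
    have sol: "sol J s v" using max by (simp add: maximal_solution_def)
    have no_ext: "J' = J" if "sol J' s' v'" "J \<subseteq> J'" "\<And>t. t \<in> J \<Longrightarrow> s' t = s t \<and> v' t = v t" for J' s' v'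
      using max that unfolding maximal_solution_def by blast
    have "J = {0..}"
    proof (rule interval_from_zero_cases[of J])
      show "is_interval J" "{0} \<subset> J" "J \<subseteq> {0..}" using sol by (simp_all add: solution_def)
    next
      fix T :: real assume T: "0 < T" and J: "J = {0..<T}"
      obtain s' v' where ext: "sol {0..T} s' v'" "\<And>t. t \<in> {0..<T} \<Longrightarrow> s' t = s t \<and> v' t = v t"
        using solution_extends_to_closed[OF sol[unfolded J] T K K\<Omega>] inK[OF sol init] J by metis
      then have "{0..T} = J" by (intro no_ext[OF ext(1)]) (use ext(2) J in auto)
      then have "T \<in> {0..<T}" using J T by (metis atLeastAtMost_iff less_imp_le order_refl)
      then show ?thesis by simp
    next
      fix T :: real assume T: "0 < T" and J: "J = {0..T}"
      have "(s T, v T) \<in> \<Omega>" using solD(4)[OF sol, of T] J T by simp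
      then obtain h s' v' where h: "0 < h" "sol {0..h} s' v'" "s' 0 = s T" "v' 0 = v T"
        using local_solution by metis
      have "{0..T + h} = J"
        by (rule no_ext[OF solution_append[OF sol[unfolded J] h(2) T h(1,3,4)]]) (use J h in auto)
      then have "T + h \<in> {0..T}" using J T h(1) by (metis add_nonneg_nonneg atLeastAtMost_iff less_imp_le order_refl)
      then show ?thesis using h(1) by simp
    qed
    then show ?thesis using inK[OF sol init] by auto
  qed
  then show ?thesis using K K\<Omega> by blast
qed

end

theorem corollary1:
  fixes n :: nat and L lam vmax vstar \<mu> :: real and V b :: "real \<Rightarrow> real"
  assumes "2 \<le> n" and "0 < L" and "L < lam" and "0 < vmax"
    and "0 < vstar" and "vstar < vmax" and "0 < \<mu>"
    and V_C3: "Ck_on 3 V {L<..}"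
    and V_nonneg: "\<And>x. L < x \<Longrightarrow> 0 \<le> V x"
    and V_lim: "filterlim V at_top (at_right L)"
    and V_zero: "\<And>x. lam \<le> x \<Longrightarrow> V x = 0"
    and V_deriv: "\<And>x. L < x \<Longrightarrow> x < lam \<Longrightarrow> deriv V x < 0"
    and V_deriv2: "\<And>x. L < x \<Longrightarrow> x < lam \<Longrightarrow> 0 < deriv (deriv V) x"
    and b_range: "\<And>x. b x \<in> {vstar - vmax<..<vstar}"
    and b_C2: "Ck_on 2 b UNIV"
    and b_mono: "mono b"
    and b_0: "b 0 = 0"
    and b_sign: "\<And>x. x \<noteq> 0 \<Longrightarrow> 0 < x * b x"
    and b_deriv_0: "0 < deriv b 0"
  shows "\<forall>S. compact S \<and> S \<subseteq> Omega_S n L vmax \<longrightarrow>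
    (\<exists>K. compact K \<and> K \<subseteq> Omega_S n L vmax \<and>
      (\<forall>J s v. maximal_solution n L V b vmax vstar \<mu> J s v \<and> (s 0, v 0) \<in> S \<longrightarrow>
         J = {0..} \<and> (\<forall>t\<ge>0. (s t, v t) \<in> K)))"
proof -
  interpret open_road n L lam vmax vstar \<mu> V b
    by unfold_locales (use assms in blast)+
  show ?thesis using uniformly_bounded_and_global by blast
qed

end
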